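(* For each unital moment category of finite type $\mathbb{C}$ there is an essentially unique (i.e. unique up to isomorphism of functors) cardinality- and unit-preserving moment functor $\gamma_{\mathbb{C}}:\mathbb{C}\to\Gamma$.
   Context: A class of morphisms is closed if it is closed under composition and contains all isomorphisms. An active/inert factorisation system on a category consists of two closed classes, of active and of inert morphisms, such that every morphism factors as $f=f_{in}f_{act}$ ($f_{act}$ active, $f_{in}$ inert), and for two such factorisations $f_{in}f_{act}=f'_{in}f'_{act}$ there is a unique isomorphism $h$ with $f_{in}=f'_{in}h$, $hf_{act}=f'_{act}$. A moment category is a category with an active/inert factorisation system such that (M1) every inert morphism has a unique active retraction; (M2) if $fi=g$ with $i$ inert and $f,g$ active, then $f=gr$ where $r$ is the unique active retraction of $i$. A moment of $A$ is an endomorphism $\phi=\phi_{in}\phi_{act}$ of $A$ ($\phi_{act}:A\to B$, $\phi_{in}:B\to A$) with $\phi_{act}\phi_{in}=1_B$; it splits over $B$. A moment functor is a functor preserving active and inert morphisms. For moments $\phi,\psi$ of the same object, they are congruent if $\phi=\phi\psi\phi$ and $\psi=\psi\phi\psi$. A unit is an object $U$ such that (U1) $U$ is primitive, i.e. $U$ has non-identity moments and all non-identity moments of $U$ are congruent; (U2) each active morphism with target $U$ has exactly one inert section. A moment category is unital if for each object $A$ there is an essentially unique pair $(U,\phi)$ of a unit $U$ and an active morphism $\phi:U\to A$. A moment is elementary if it splits over a unit. The cardinality of an object is the cardinality of its set of elementary moments. A unital moment category is of finite type if its underlying category is small and every object has finite cardinality. A functor between unital moment categories is cardinality-preserving if each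 object has the same cardinality as its image, and unit-preserving if it takes units to units. Segal's category $\Gamma$ has objects $\underline{n}=\{1,\dots,n\}$, $n\ge 0$; a morphism $\underline{m}\to\underline{n}$ is an $m$-tuple $(N_1,\dots,N_m)$ of pairwise disjoint subsets of $\underline{n}$; the composite of $(M_1,\dots,M_k):\underline{k}\to\underline{m}$ and $(N_1,\dots,N_m):\underline{m}\to\underline{n}$ is $(\bigcup_{j\in M_1}N_j,\dots,\bigcup_{j\in M_k}N_j)$. The morphism $(N_1,\dots,N_m)$ is active if $\underline{n}=\bigsqcup_iN_i$, inert if each $N_i$ is a singleton. This makes $\Gamma$ a unital moment category with unit $\underline{1}$, in which $\underline{n}$ has cardinality $n$. *)

theory Defs
  imports Main "HOL-Library.Disjoint_Sets" "HOL-Library.Equipollence"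
begin

section \<open>Categories and functors\<close>

text \<open>Since objects and morphisms form HOL sets, every category considered here is small.
  Composition is written in the usual order and is only meaningful on composable pairs.\<close>

record ('o, 'a) precategory =
  Obj :: "'o set"
  Mor :: "'a set"
  Dom :: "'a \<Rightarrow> 'o"
  Cod :: "'a \<Rightarrow> 'o"
  Id :: "'o \<Rightarrow> 'a"
  Comp :: "'a \<Rightarrow> 'a \<Rightarrow> 'a" (infixl "\<cdot>\<index>" 70)

definition Hom :: "('o, 'a, 'z) precategory_scheme \<Rightarrow> 'o \<Rightarrow> 'o \<Rightarrow> 'a set" where
  "Hom C A B = {f \<in> Mor C. Dom C f = A \<and> Cod C f = B}"

locale category =
  fixes C :: "('o, 'a, 'z) precategory_scheme" (structure)
  assumes Dom_in_Obj: "f \<in> Mor C \<Longrightarrow> Dom C f \<in> Obj C"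
    and Cod_in_Obj: "f \<in> Mor C \<Longrightarrow> Cod C f \<in> Obj C"
    and Id_in_Hom: "A \<in> Obj C \<Longrightarrow> Id C A \<in> Hom C A A"
    and Comp_in_Hom: "f \<in> Hom C A B \<Longrightarrow> g \<in> Hom C B D \<Longrightarrow> g \<cdot> f \<in> Hom C A D"
    and Comp_Id: "f \<in> Hom C A B \<Longrightarrow> f \<cdot> Id C A = f"
    and Id_Comp: "f \<in> Hom C A B \<Longrightarrow> Id C B \<cdot> f = f"
    and Comp_assoc: "f \<in> Hom C A B \<Longrightarrow> g \<in> Hom C B D \<Longrightarrow> h \<in> Hom C D E \<Longrightarrow>
      (h \<cdot> g) \<cdot> f = h \<cdot> (g \<cdot> f)"

definition Iso :: "('o, 'a, 'z) precategory_scheme \<Rightarrow> 'o \<Rightarrow> 'o \<Rightarrow> 'a set" where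
  "Iso C A B = {f \<in> Hom C A B.
     \<exists>g \<in> Hom C B A. Comp C g f = Id C A \<and> Comp C f g = Id C B}"

definition closed_class :: "('o, 'a, 'z) precategory_scheme \<Rightarrow> 'a set \<Rightarrow> bool" where
  "closed_class C S \<longleftrightarrow> S \<subseteq> Mor C \<and>
     (\<forall>f \<in> S. \<forall>g \<in> S. Cod C f = Dom C g \<longrightarrow> Comp C g f \<in> S) \<and>
     (\<forall>A \<in> Obj C. \<forall>B \<in> Obj C. Iso C A B \<subseteq> S)"

record ('o, 'a, 'p, 'b) cat_functor =
  on_obj :: "'o \<Rightarrow> 'p"
  on_mor :: "'a \<Rightarrow> 'b"

definition is_functor ::
  "('o, 'a, 'z) precategory_scheme \<Rightarrow> ('p, 'b, 'y) precategory_scheme \<Rightarrow>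
   ('o, 'a, 'p, 'b) cat_functor \<Rightarrow> bool" where
  "is_functor C D F \<longleftrightarrow>
     (\<forall>A \<in> Obj C. on_obj F A \<in> Obj D) \<and>
     (\<forall>f \<in> Mor C. on_mor F f \<in> Hom D (on_obj F (Dom C f)) (on_obj F (Cod C f))) \<and>
     (\<forall>A \<in> Obj C. on_mor F (Id C A) = Id D (on_obj F A)) \<and>
     (\<forall>f \<in> Mor C. \<forall>g \<in> Mor C. Cod C f = Dom C g \<longrightarrow>
        on_mor F (Comp C g f) = Comp D (on_mor F g) (on_mor F f))"

definition naturally_isomorphic ::
  "('o, 'a, 'z) precategory_scheme \<Rightarrow> ('p, 'b, 'y) precategory_scheme \<Rightarrow>
   ('o, 'a, 'p, 'b) cat_functor \<Rightarrow> ('o, 'a, 'p, 'b) cat_functor \<Rightarrow> bool" where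
  "naturally_isomorphic C D F G \<longleftrightarrow>
     (\<exists>\<eta>. (\<forall>A \<in> Obj C. \<eta> A \<in> Iso D (on_obj F A) (on_obj G A)) \<and>
          (\<forall>f \<in> Mor C. Comp D (on_mor G f) (\<eta> (Dom C f)) = Comp D (\<eta> (Cod C f)) (on_mor F f)))"


section \<open>Moment categories\<close>

record ('o, 'a) factorised_precategory = "('o, 'a) precategory" +
  Act :: "'a set"
  Inert :: "'a set"

locale active_inert_category = category C
  for C :: "('o, 'a, 'z) factorised_precategory_scheme" (structure) +
  assumes closed_Act: "closed_class C (Act C)"
    and closed_Inert: "closed_class C (Inert C)"
    and factorisation: "f \<in> Mor C \<Longrightarrow>
      \<exists>a \<in> Act C. \<exists>i \<in> Inert C. Cod C a = Dom C i \<and> f = i \<cdot> a"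
    and factorisation_unique:
      "a \<in> Act C \<Longrightarrow> i \<in> Inert C \<Longrightarrow> Cod C a = Dom C i \<Longrightarrow>
       a' \<in> Act C \<Longrightarrow> i' \<in> Inert C \<Longrightarrow> Cod C a' = Dom C i' \<Longrightarrow>
       i \<cdot> a = i' \<cdot> a' \<Longrightarrow>
       \<exists>!h. h \<in> Iso C (Cod C a) (Cod C a') \<and> i = i' \<cdot> h \<and> h \<cdot> a = a'"

definition active_retraction ::
  "('o, 'a, 'z) factorised_precategory_scheme \<Rightarrow> 'a \<Rightarrow> 'a \<Rightarrow> bool" where
  "active_retraction C i r \<longleftrightarrow>
     r \<in> Act C \<and> r \<in> Hom C (Cod C i) (Dom C i) \<and> Comp C r i = Id C (Dom C i)"

definition inert_section ::
  "('o, 'a, 'z) factorised_precategory_scheme \<Rightarrow> 'a \<Rightarrow> 'a \<Rightarrow> bool" where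
  "inert_section C r i \<longleftrightarrow>
     i \<in> Inert C \<and> i \<in> Hom C (Cod C r) (Dom C r) \<and> Comp C r i = Id C (Cod C r)"

locale moment_category = active_inert_category C
  for C :: "('o, 'a, 'z) factorised_precategory_scheme" (structure) +
  assumes M1: "i \<in> Inert C \<Longrightarrow> \<exists>!r. active_retraction C i r"
    and M2: "i \<in> Inert C \<Longrightarrow> f \<in> Act C \<Longrightarrow> g \<in> Act C \<Longrightarrow> Cod C i = Dom C f \<Longrightarrow> f \<cdot> i = g \<Longrightarrow>
      active_retraction C i r \<Longrightarrow> f = g \<cdot> r"

definition splits_over ::
  "('o, 'a, 'z) factorised_precategory_scheme \<Rightarrow> 'o \<Rightarrow> 'a \<Rightarrow> 'o \<Rightarrow> bool" where
  "splits_over C A \<phi> B \<longleftrightarrow>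
     (\<exists>a \<in> Act C \<inter> Hom C A B. \<exists>i \<in> Inert C \<inter> Hom C B A.
        \<phi> = Comp C i a \<and> Comp C a i = Id C B)"

definition moments :: "('o, 'a, 'z) factorised_precategory_scheme \<Rightarrow> 'o \<Rightarrow> 'a set" where
  "moments C A = {\<phi> \<in> Hom C A A. \<exists>B \<in> Obj C. splits_over C A \<phi> B}"

definition congruent_moments ::
  "('o, 'a, 'z) precategory_scheme \<Rightarrow> 'a \<Rightarrow> 'a \<Rightarrow> bool" where
  "congruent_moments C \<phi> \<psi> \<longleftrightarrow>
     \<phi> = Comp C (Comp C \<phi> \<psi>) \<phi> \<and> \<psi> = Comp C (Comp C \<psi> \<phi>) \<psi>"

definition primitive_object ::
  "('o, 'a, 'z) factorised_precategory_scheme \<Rightarrow> 'o \<Rightarrow> bool" where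
  "primitive_object C U \<longleftrightarrow> U \<in> Obj C \<and> moments C U - {Id C U} \<noteq> {} \<and>
     (\<forall>\<phi> \<in> moments C U - {Id C U}. \<forall>\<psi> \<in> moments C U - {Id C U}. congruent_moments C \<phi> \<psi>)"

definition unit_object ::
  "('o, 'a, 'z) factorised_precategory_scheme \<Rightarrow> 'o \<Rightarrow> bool" where
  "unit_object C U \<longleftrightarrow> primitive_object C U \<and>
     (\<forall>r \<in> Act C. Cod C r = U \<longrightarrow> (\<exists>!i. inert_section C r i))"

text \<open>``Essentially unique'' means unique up to isomorphism: any two such pairs are
  related by an isomorphism of units compatible with the active morphisms.\<close>

locale unital_moment_category = moment_category C
  for C :: "('o, 'a, 'z) factorised_precategory_scheme" (structure) +
  assumes unit_exists: "A \<in> Obj C \<Longrightarrow>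
      \<exists>U u. unit_object C U \<and> u \<in> Act C \<inter> Hom C U A"
    and unit_essentially_unique: "A \<in> Obj C \<Longrightarrow>
      unit_object C U \<Longrightarrow> u \<in> Act C \<inter> Hom C U A \<Longrightarrow>
      unit_object C V \<Longrightarrow> v \<in> Act C \<inter> Hom C V A \<Longrightarrow>
      \<exists>h \<in> Iso C U V. v \<cdot> h = u"

definition elementary_moments ::
  "('o, 'a, 'z) factorised_precategory_scheme \<Rightarrow> 'o \<Rightarrow> 'a set" where
  "elementary_moments C A =
     {\<phi> \<in> moments C A. \<exists>U. unit_object C U \<and> splits_over C A \<phi> U}"

text \<open>Smallness of the underlying category is automatic.\<close>

locale finite_type_unital_moment_category = unital_moment_category C
  for C :: "('o, 'a, 'z) factorised_precategory_scheme" (structure) +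
  assumes finite_cardinality: "A \<in> Obj C \<Longrightarrow> finite (elementary_moments C A)"

definition moment_functor ::
  "('o, 'a, 'z) factorised_precategory_scheme \<Rightarrow> ('p, 'b, 'y) factorised_precategory_scheme \<Rightarrow>
   ('o, 'a, 'p, 'b) cat_functor \<Rightarrow> bool" where
  "moment_functor C D F \<longleftrightarrow> is_functor C D F \<and>
     (\<forall>f \<in> Act C. on_mor F f \<in> Act D) \<and> (\<forall>f \<in> Inert C. on_mor F f \<in> Inert D)"

definition cardinality_preserving ::
  "('o, 'a, 'z) factorised_precategory_scheme \<Rightarrow> ('p, 'b, 'y) factorised_precategory_scheme \<Rightarrow>
   ('o, 'a, 'p, 'b) cat_functor \<Rightarrow> bool" where
  "cardinality_preserving C D F \<longleftrightarrow>
     (\<forall>A \<in> Obj C. elementary_moments C A \<approx> elementary_moments D (on_obj F A))"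

definition unit_preserving ::
  "('o, 'a, 'z) factorised_precategory_scheme \<Rightarrow> ('p, 'b, 'y) factorised_precategory_scheme \<Rightarrow>
   ('o, 'a, 'p, 'b) cat_functor \<Rightarrow> bool" where
  "unit_preserving C D F \<longleftrightarrow> (\<forall>U. unit_object C U \<longrightarrow> unit_object D (on_obj F U))"


section \<open>Segal's category\<close>

text \<open>The object \<open>{1, \<dots>, n}\<close> is encoded by \<open>n\<close>. A morphism from \<open>m\<close> to \<open>n\<close> is
  encoded as \<open>(m, N, n)\<close>, where the function \<open>N\<close> represents the tuple \<open>(N 1, \<dots>, N m)\<close>
  and is normalised to be empty outside \<open>{1..m}\<close>, so that equality of morphisms is
  equality of tuples. Composition does not need to enforce the normalisation, because the
  union over an empty index set is empty.\<close>

type_synonym gamma_mor = "nat \<times> (nat \<Rightarrow> nat set) \<times> nat"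

definition gamma_mors :: "gamma_mor set" where
  "gamma_mors = {(m, N, n). (\<forall>i \<in> {1..m}. N i \<subseteq> {1..n}) \<and>
     disjoint_family_on N {1..m} \<and> (\<forall>i. i \<notin> {1..m} \<longrightarrow> N i = {})}"

definition Gamma :: "(nat, gamma_mor) factorised_precategory" where
  "Gamma = \<lparr>
     Obj = UNIV,
     Mor = gamma_mors,
     Dom = (\<lambda>(m, N, n). m),
     Cod = (\<lambda>(m, N, n). n),
     Id = (\<lambda>n. (n, \<lambda>i. if i \<in> {1..n} then {i} else {}, n)),
     Comp = (\<lambda>(m, N, n) (k, M, l). (k, \<lambda>i. \<Union>j \<in> M i. N j, n)),
     Act = {(m, N, n) \<in> gamma_mors. (\<Union>i \<in> {1..m}. N i) = {1..n}},
     Inert = {(m, N, n) \<in> gamma_mors. \<forall>i \<in> {1..m}. is_singleton (N i)}\<rparr>"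

end

theory Submission
  imports Defs
begin

text \<open>For \<open>f : A \<rightarrow> B\<close> and elementary moments \<open>\<phi> = i r\<close> of \<open>A\<close> and \<open>\<psi> = j s\<close> of \<open>B\<close>, call
  \<open>\<phi>\<close> and \<open>\<psi>\<close> incident along \<open>f\<close> if the map \<open>s f i\<close> between units is invertible. Three facts drive
  everything: split epimorphisms are active, active maps between units are invertible, and
  by (U2) an active map to a unit has a unique inert section. They show that incidence composes like
  relations, that each \<open>\<psi>\<close> is incident to at most one \<open>\<phi>\<close> (exactly one if \<open>f\<close> is active), and
  that for inert \<open>f\<close> each \<open>\<phi>\<close> is incident to exactly one \<open>\<psi>\<close>. Numbering elementary moments turns
  incidence into a functor to \<open>\<Gamma>\<close>.

  Conversely, let \<open>F\<close> be any such functor. A map \<open>x\<close> between units whose image is non-empty is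
  invertible: the object through which \<open>x\<close> factors has positive cardinality, and an elementary
  moment of it splits the inert part of \<open>x\<close>. Hence \<open>F\<close> is itself given by incidence,
  for the numbering that sends \<open>\<phi> = i r\<close> to the only element of the singleton \<open>F i\<close>.\<close>

section \<open>Split epimorphisms and units\<close>

context category
begin

lemma Id_simps [simp]:
  assumes "A \<in> Obj C"
  shows "Id C A \<in> Mor C" "Dom C (Id C A) = A" "Cod C (Id C A) = A"
  using Id_in_Hom[OF assms] by (auto simp: Hom_def)

lemma Comp_simps [simp]:
  assumes "f \<in> Mor C" "g \<in> Mor C" "Cod C f = Dom C g"
  shows "g \<cdot> f \<in> Mor C" "Dom C (g \<cdot> f) = Dom C f" "Cod C (g \<cdot> f) = Cod C g"
  using Comp_in_Hom[of f "Dom C f" "Cod C f" g "Cod C g"] assms by (auto simp: Hom_def)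

lemma Comp_assoc_Mor [simp]:
  assumes "f \<in> Mor C" "g \<in> Mor C" "h \<in> Mor C" "Cod C f = Dom C g" "Cod C g = Dom C h"
  shows "(h \<cdot> g) \<cdot> f = h \<cdot> (g \<cdot> f)"
  using Comp_assoc[of f "Dom C f" "Cod C f" g "Cod C g" h "Cod C h"] assms by (auto simp: Hom_def)

lemma Comp_Id_Mor [simp]: "f \<in> Mor C \<Longrightarrow> A = Dom C f \<Longrightarrow> f \<cdot> Id C A = f"
  using Comp_Id[of f "Dom C f" "Cod C f"] by (auto simp: Hom_def)

lemma Id_Comp_Mor [simp]: "f \<in> Mor C \<Longrightarrow> A = Cod C f \<Longrightarrow> Id C A \<cdot> f = f"
  using Id_Comp[of f "Dom C f" "Cod C f"] by (auto simp: Hom_def)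

text \<open>The simplifier brackets composites to the right, so a retraction and its section need
  not form a subterm of their own. This is the form in which they still cancel.\<close>

lemma Comp_cancel:
  assumes "r \<cdot> i = Id C (Cod C x)" "r \<in> Mor C" "i \<in> Mor C" "x \<in> Mor C"
    "Cod C i = Dom C r" "Cod C x = Dom C i"
  shows "r \<cdot> (i \<cdot> x) = x"
  using Comp_assoc_Mor[of x i r] assms by (simp del: Comp_assoc_Mor)

lemma IsoI:
  assumes "f \<in> Mor C" "Dom C f = A" "Cod C f = B" "g \<in> Mor C" "Dom C g = B" "Cod C g = A"
    "g \<cdot> f = Id C A" "f \<cdot> g = Id C B"
  shows "f \<in> Iso C A B"
  using assms by (auto simp: Iso_def Hom_def)

lemma Id_Iso: "A \<in> Obj C \<Longrightarrow> Id C A \<in> Iso C A A"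
  by (rule IsoI[where g = "Id C A"]) simp_all

lemma Iso_arrow:
  assumes "f \<in> Iso C A B"
  shows "f \<in> Mor C" "Dom C f = A" "Cod C f = B" "A \<in> Obj C" "B \<in> Obj C"
  using assms Dom_in_Obj Cod_in_Obj by (auto simp: Iso_def Hom_def)

lemma Iso_inverse:
  assumes "f \<in> Iso C A B"
  obtains g where "g \<in> Iso C B A" "g \<cdot> f = Id C A" "f \<cdot> g = Id C B"
  using assms by (auto simp: Iso_def)

lemma Iso_Comp:
  assumes f: "f \<in> Iso C A B" and g: "g \<in> Iso C B D"
  shows "g \<cdot> f \<in> Iso C A D"
proof -
  obtain f' where f': "f' \<in> Iso C B A" "f' \<cdot> f = Id C A" "f \<cdot> f' = Id C B"
    using Iso_inverse[OF f] .
  obtain g' where g': "g' \<in> Iso C D B" "g' \<cdot> g = Id C B" "g \<cdot> g' = Id C D"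
    using Iso_inverse[OF g] .
  note [simp] = Iso_arrow[OF f] Iso_arrow[OF g] Iso_arrow[OF f'(1)] Iso_arrow[OF g'(1)]
  show ?thesis
    using f' g' by (intro IsoI[where g = "f' \<cdot> g'"]) (simp_all add: Comp_cancel)
qed

end

section \<open>Active retractions and split epimorphisms\<close>

context moment_category
begin

lemma Act_Mor: "f \<in> Act C \<Longrightarrow> f \<in> Mor C"
  and Act_Comp: "f \<in> Act C \<Longrightarrow> g \<in> Act C \<Longrightarrow> Cod C f = Dom C g \<Longrightarrow> g \<cdot> f \<in> Act C"
  using closed_Act by (auto simp: closed_class_def)

lemma Inert_Mor: "f \<in> Inert C \<Longrightarrow> f \<in> Mor C"
  and Inert_Comp: "f \<in> Inert C \<Longrightarrow> g \<in> Inert C \<Longrightarrow> Cod C f = Dom C g \<Longrightarrow> g \<cdot> f \<in> Inert C"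
  using closed_Inert by (auto simp: closed_class_def)

lemma Iso_Act: "f \<in> Iso C A B \<Longrightarrow> f \<in> Act C"
  and Iso_Inert: "f \<in> Iso C A B \<Longrightarrow> f \<in> Inert C"
  using closed_Act closed_Inert Iso_arrow(4,5)[of f A B] unfolding closed_class_def by blast+

lemma retraction_exists:
  assumes "i \<in> Inert C"
  obtains r where "active_retraction C i r" "r \<in> Act C" "r \<in> Mor C" "Dom C r = Cod C i"
    "Cod C r = Dom C i" "r \<cdot> i = Id C (Dom C i)"
  using M1[OF assms] by (auto simp: active_retraction_def Hom_def)

lemma retraction_unique:
  "i \<in> Inert C \<Longrightarrow> active_retraction C i r \<Longrightarrow> active_retraction C i r' \<Longrightarrow> r = r'"
  using M1 by blast

text \<open>With the uniqueness in (M1), this computes the retraction of any inert map that is given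
  as a composite of inert maps.\<close>

lemma retraction_Comp:
  assumes i: "active_retraction C i r" "i \<in> Inert C" and j: "active_retraction C j s" "j \<in> Inert C"
    and c: "Cod C i = Dom C j"
  shows "active_retraction C (j \<cdot> i) (r \<cdot> s)"
  using assms Inert_Mor[OF i(2)] Inert_Mor[OF j(2)] Dom_in_Obj
  by (simp add: active_retraction_def Hom_def Act_Comp Comp_cancel)

text \<open>The inert part of a split epimorphism is split both ways, hence invertible.\<close>

lemma split_epi_active:
  assumes x: "x \<in> Hom C A B" and y: "y \<in> Hom C D A" and xy: "x \<cdot> y \<in> Iso C D B"
  shows "x \<in> Act C"
proof -
  have x': "x \<in> Mor C" "Dom C x = A" "Cod C x = B" and y': "y \<in> Mor C" "Dom C y = D" "Cod C y = A"
    using x y by (auto simp: Hom_def)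
  obtain a m where a: "a \<in> Act C" and m: "m \<in> Inert C" and am: "Cod C a = Dom C m" "x = m \<cdot> a"
    using factorisation x' by blast
  note [simp] = Act_Mor[OF a] Inert_Mor[OF m]
  have [simp]: "Cod C m = B" "Dom C a = A"
    using x' am by auto
  obtain z where z: "z \<in> Iso C B D" "(x \<cdot> y) \<cdot> z = Id C B"
    using Iso_inverse[OF xy] by metis
  note [simp] = Iso_arrow[OF z(1)]
  obtain r where r: "r \<in> Mor C" "Dom C r = B" "Cod C r = Dom C m" "r \<cdot> m = Id C (Dom C m)"
    using retraction_exists[OF m] by auto
  \<comment> \<open>Since \<open>m \<cdot> a \<cdot> y\<close> is \<open>x \<cdot> y\<close>, whose
    inverse is \<open>z\<close>, this \<open>w\<close> is a right inverse of \<open>m\<close>. It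
    has to agree with the left inverse \<open>r\<close>.\<close>
  define w where "w = a \<cdot> (y \<cdot> z)"
  have w: "w \<in> Mor C" "Dom C w = B" "Cod C w = Dom C m" "m \<cdot> w = Id C B"
    using z(2) x' y' am by (simp_all add: w_def)
  have "r \<cdot> (m \<cdot> w) = w"
    using r by - (rule Comp_cancel, simp_all add: w(1-3))
  then have "r = w"
    using r unfolding w(4) by simp
  then have "m \<in> Iso C (Dom C m) B"
    using r w by (intro IsoI[where g = r]) simp_all
  then show ?thesis
    using Act_Comp[OF a Iso_Act] am by auto
qed

end

section \<open>Units and the maps between them\<close>

context unital_moment_category
begin

lemma unit_Obj: "unit_object C U \<Longrightarrow> U \<in> Obj C"
  by (auto simp: unit_object_def primitive_object_def)

text \<open>Both \<open>a\<close> and the identity of \<open>V\<close> are active maps from a unit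
  to \<open>V\<close>. Essential uniqueness compares them by an isomorphism, which can only be
  \<open>a\<close> itself.\<close>

lemma active_between_units_Iso:
  assumes "unit_object C U" "unit_object C V" "a \<in> Act C" "Dom C a = U" "Cod C a = V"
  shows "a \<in> Iso C U V"
proof -
  have "a \<in> Act C \<inter> Hom C U V" "Id C V \<in> Act C \<inter> Hom C V V"
    using assms Act_Mor[OF assms(3)] unit_Obj[OF assms(2)] Iso_Act[OF Id_Iso]
    by (simp_all add: Hom_def)
  then obtain h where h: "h \<in> Iso C U V" "Id C V \<cdot> h = a"
    using unit_essentially_unique[OF unit_Obj[OF assms(2)]] assms(1,2) by blast
  then show ?thesis
    using Iso_arrow[OF h(1)] by simp
qed

text \<open>The active retraction of \<open>i\<close> is an active map between units, hence
  invertible, and \<open>i\<close> is then its inverse.\<close>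

lemma inert_between_units_Iso:
  assumes "unit_object C U" "unit_object C V" "i \<in> Inert C" "Dom C i = U" "Cod C i = V"
  shows "i \<in> Iso C U V"
proof -
  obtain r where r: "r \<in> Act C" "Dom C r = V" "Cod C r = U" "r \<cdot> i = Id C U"
    using retraction_exists[OF assms(3)] assms by metis
  then have "r \<in> Iso C V U"
    using active_between_units_Iso assms by blast
  then obtain j where j: "j \<in> Iso C U V" "j \<cdot> r = Id C V"
    by (rule Iso_inverse)
  have "i = j"
    using Comp_cancel[of j r i] Iso_arrow[OF j(1)] j(2) r assms(4,5) Inert_Mor[OF assms(3)]
      Act_Mor[OF r(1)] by simp
  then show ?thesis
    using j by simp
qed

lemma unit_section_exists:
  assumes "unit_object C U" "r \<in> Act C" "Cod C r = U"
  obtains i where "i \<in> Inert C" "i \<in> Mor C" "Dom C i = U" "Cod C i = Dom C r" "r \<cdot> i = Id C U"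
proof -
  obtain i where "inert_section C r i"
    using assms unfolding unit_object_def by blast
  then show ?thesis
    using that[of i] assms(3) by (auto simp: inert_section_def Hom_def)
qed

lemma unit_section_unique:
  assumes "unit_object C U" "r \<in> Act C" "Cod C r = U"
    and "i \<in> Inert C" "Dom C i = U" "Cod C i = Dom C r" "r \<cdot> i = Id C U"
    and "j \<in> Inert C" "Dom C j = U" "Cod C j = Dom C r" "r \<cdot> j = Id C U"
  shows "i = j"
proof -
  have "inert_section C r i" "inert_section C r j"
    using assms Inert_Mor by (auto simp: inert_section_def Hom_def)
  then show ?thesis
    using assms(1,2,3) unfolding unit_object_def by blast
qed

section \<open>Incidence of elementary moments\<close>

text \<open>A splitting of a moment is determined only up to an isomorphism of the unit, so one is
  fixed by choice. The object that carries the moment is read off as \<open>Dom C \<phi>\<close> and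
  need not be an argument. The retraction is then forced by (M1).\<close>

definition unit_inclusion :: "'a \<Rightarrow> 'a" where
  "unit_inclusion \<phi> = (SOME i. i \<in> Inert C \<and> Cod C i = Dom C \<phi> \<and> unit_object C (Dom C i) \<and>
     (\<exists>r. active_retraction C i r \<and> \<phi> = i \<cdot> r))"

definition unit_retraction :: "'a \<Rightarrow> 'a" where
  "unit_retraction \<phi> = (THE r. active_retraction C (unit_inclusion \<phi>) r)"

definition unit_of :: "'a \<Rightarrow> 'o" where
  "unit_of \<phi> = Dom C (unit_inclusion \<phi>)"

lemma Dom_unit_inclusion [simp]: "Dom C (unit_inclusion \<phi>) = unit_of \<phi>"
  by (simp add: unit_of_def)

lemma elementary_splitting:
  assumes "\<phi> \<in> elementary_moments C A"
  shows "unit_inclusion \<phi> \<in> Inert C" "unit_inclusion \<phi> \<in> Mor C" "Cod C (unit_inclusion \<phi>) = A"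
    "unit_object C (unit_of \<phi>)"
    "active_retraction C (unit_inclusion \<phi>) (unit_retraction \<phi>)"
    "unit_retraction \<phi> \<in> Act C" "unit_retraction \<phi> \<in> Mor C" "Dom C (unit_retraction \<phi>) = A"
    "Cod C (unit_retraction \<phi>) = unit_of \<phi>"
    "unit_retraction \<phi> \<cdot> unit_inclusion \<phi> = Id C (unit_of \<phi>)"
    and elementary_eq: "unit_inclusion \<phi> \<cdot> unit_retraction \<phi> = \<phi>"
proof -
  obtain U a i where i: "\<phi> \<in> Hom C A A" "unit_object C U" "a \<in> Act C" "a \<in> Hom C A U" "i \<in> Inert C"
    "i \<in> Hom C U A" "\<phi> = i \<cdot> a" "a \<cdot> i = Id C U"
    using assms unfolding elementary_moments_def moments_def splits_over_def by blast
  define P where "P = (\<lambda>i. i \<in> Inert C \<and> Cod C i = Dom C \<phi> \<and> unit_object C (Dom C i) \<and>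
     (\<exists>r. active_retraction C i r \<and> \<phi> = i \<cdot> r))"
  have "active_retraction C i a"
    using i by (simp add: Hom_def active_retraction_def)
  then have "P i"
    using i(1,2,5,6,7) unfolding P_def Hom_def by blast
  then have "P (SOME i. P i)"
    by (rule someI[of P])
  then have *: "unit_inclusion \<phi> \<in> Inert C" "Cod C (unit_inclusion \<phi>) = Dom C \<phi>"
    "unit_object C (unit_of \<phi>)" "\<exists>r. active_retraction C (unit_inclusion \<phi>) r \<and> \<phi> = unit_inclusion \<phi> \<cdot> r"
    unfolding P_def unit_inclusion_def[symmetric] Dom_unit_inclusion by blast+
  then obtain r where r: "active_retraction C (unit_inclusion \<phi>) r" "unit_inclusion \<phi> \<cdot> r = \<phi>"
    by metis
  have u: "unit_inclusion \<phi> \<in> Inert C" "Cod C (unit_inclusion \<phi>) = Dom C \<phi>"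
    "unit_object C (unit_of \<phi>)"
    using * by blast+
  then have "unit_retraction \<phi> = r"
    unfolding unit_retraction_def using M1 r(1) by blast
  with u r show "unit_inclusion \<phi> \<in> Inert C" "unit_inclusion \<phi> \<in> Mor C"
    "Cod C (unit_inclusion \<phi>) = A" "unit_object C (unit_of \<phi>)"
    "active_retraction C (unit_inclusion \<phi>) (unit_retraction \<phi>)"
    "unit_retraction \<phi> \<in> Act C" "unit_retraction \<phi> \<in> Mor C" "Dom C (unit_retraction \<phi>) = A"
    "Cod C (unit_retraction \<phi>) = unit_of \<phi>"
    "unit_retraction \<phi> \<cdot> unit_inclusion \<phi> = Id C (unit_of \<phi>)"
    "unit_inclusion \<phi> \<cdot> unit_retraction \<phi> = \<phi>"
    using i(1) Inert_Mor by (auto simp: Hom_def active_retraction_def)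
qed

lemma elementary_Obj: "\<phi> \<in> elementary_moments C A \<Longrightarrow> A \<in> Obj C"
  using elementary_splitting Cod_in_Obj by metis

text \<open>The moment is \<open>i\<close> after its active retraction. Its chosen splitting is a
  second active/inert factorisation of the same endomorphism, so the two inclusions differ by an
  isomorphism of units. Every later construction of an elementary moment goes through this
  lemma.\<close>

lemma elementary_of_inert:
  assumes i: "i \<in> Inert C" "Cod C i = A" "unit_object C (Dom C i)"
  obtains \<phi> h where "\<phi> \<in> elementary_moments C A" "h \<in> Iso C (unit_of \<phi>) (Dom C i)"
    "unit_inclusion \<phi> = i \<cdot> h"
proof -
  obtain r where r: "r \<in> Act C" "r \<in> Mor C" "Dom C r = A" "Cod C r = Dom C i"
      "r \<cdot> i = Id C (Dom C i)"
    using retraction_exists[OF i(1)] i(2) by metis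
  have split: "splits_over C A (i \<cdot> r) (Dom C i)"
    using i r Inert_Mor by (auto simp: splits_over_def Hom_def)
  have el: "i \<cdot> r \<in> elementary_moments C A"
    using split i r Inert_Mor[OF i(1)] unit_Obj
    by (auto simp: elementary_moments_def moments_def Hom_def)
  note s = elementary_splitting[OF el]
  have "\<exists>!h. h \<in> Iso C (Cod C (unit_retraction (i \<cdot> r))) (Cod C r) \<and>
      unit_inclusion (i \<cdot> r) = i \<cdot> h \<and> h \<cdot> unit_retraction (i \<cdot> r) = r"
    using s(1,6,9) elementary_eq[OF el] r i by (intro factorisation_unique) auto
  then show ?thesis
    using that[OF el] s(9) r(4) by auto
qed

text \<open>The inverse of \<open>h\<close> is an active retraction of \<open>h\<close>. By
  uniqueness of retractions, \<open>unit_retraction \<phi>\<close> is this inverse after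
  \<open>unit_retraction \<psi>\<close>, so \<open>h\<close> cancels in the product that gives
  \<open>\<phi>\<close>.\<close>

lemma elementary_eqI:
  assumes \<phi>: "\<phi> \<in> elementary_moments C A" and \<psi>: "\<psi> \<in> elementary_moments C A"
    and h: "h \<in> Iso C (unit_of \<phi>) (unit_of \<psi>)"
    and eq: "unit_inclusion \<phi> = unit_inclusion \<psi> \<cdot> h"
  shows "\<phi> = \<psi>"
proof -
  note s = elementary_splitting[OF \<phi>] and t = elementary_splitting[OF \<psi>]
  obtain g where g: "g \<in> Iso C (unit_of \<psi>) (unit_of \<phi>)" "g \<cdot> h = Id C (unit_of \<phi>)"
      "h \<cdot> g = Id C (unit_of \<psi>)"
    using Iso_inverse[OF h] .
  have "active_retraction C h g"
    using g Iso_arrow[OF h] Iso_arrow[OF g(1)] Iso_Act[OF g(1)]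
    by (auto simp: active_retraction_def Hom_def)
  then have "active_retraction C (unit_inclusion \<phi>) (g \<cdot> unit_retraction \<psi>)"
    unfolding eq using retraction_Comp[OF _ Iso_Inert[OF h] t(5,1)] Iso_arrow[OF h] by simp
  then have "unit_retraction \<phi> = g \<cdot> unit_retraction \<psi>"
    using retraction_unique s(1,5) by blast
  then have "\<phi> = (unit_inclusion \<psi> \<cdot> h) \<cdot> (g \<cdot> unit_retraction \<psi>)"
    using elementary_eq[OF \<phi>] eq by simp
  also have "\<dots> = unit_inclusion \<psi> \<cdot> unit_retraction \<psi>"
    using t Iso_arrow[OF h] Iso_arrow[OF g(1)] g(3) by (simp add: Comp_cancel)
  finally show ?thesis
    using elementary_eq[OF \<psi>] by simp
qed

text \<open>In \<open>\<Gamma>\<close>, incidence of the \<open>i\<close>-th and \<open>j\<close>-th elementary moments along \<open>(N\<^sub>1, \<dots>, N\<^sub>m)\<close>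
  means \<open>j \<in> N\<^sub>i\<close>.\<close>

definition incident :: "'a \<Rightarrow> 'a \<Rightarrow> 'a \<Rightarrow> bool" where
  "incident f \<phi> \<psi> \<longleftrightarrow>
     unit_retraction \<psi> \<cdot> (f \<cdot> unit_inclusion \<phi>) \<in> Iso C (unit_of \<phi>) (unit_of \<psi>)"

text \<open>Only the inert part \<open>k\<close> of \<open>f\<close> on the unit of
  \<open>\<phi>\<close> matters. If the map that defines incidence is invertible, then
  \<open>unit_retraction \<psi> \<cdot> k\<close> is a split epimorphism, hence active, and (U2)
  provides an inert section, through which \<open>unit_inclusion \<psi>\<close> factors. Conversely,
  such a factorisation cancels \<open>k\<close> and leaves an active map between units.\<close>

lemma incident_iff_factors:
  assumes f: "f \<in> Hom C A B" and \<phi>: "\<phi> \<in> elementary_moments C A"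
    and \<psi>: "\<psi> \<in> elementary_moments C B"
    and a: "a \<in> Act C" and k: "k \<in> Inert C" and c: "Cod C a = Dom C k"
    and eq: "f \<cdot> unit_inclusion \<phi> = k \<cdot> a"
  shows "incident f \<phi> \<psi> \<longleftrightarrow>
    (\<exists>t \<in> Inert C. Dom C t = unit_of \<psi> \<and> Cod C t = Dom C k \<and> unit_inclusion \<psi> = k \<cdot> t)"
proof -
  note s = elementary_splitting[OF \<phi>] and t = elementary_splitting[OF \<psi>]
  have f': "f \<in> Mor C" "Dom C f = A" "Cod C f = B"
    using f by (auto simp: Hom_def)
  note [simp] = Act_Mor[OF a] Inert_Mor[OF k] s(2,3) t(2,3,7,8,9) c
  have "Dom C (k \<cdot> a) = unit_of \<phi>" "Cod C (k \<cdot> a) = B"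
    unfolding eq[symmetric] using f' by simp_all
  then have [simp]: "Dom C a = unit_of \<phi>" "Cod C k = B"
    by simp_all
  show ?thesis
  proof
    assume "incident f \<phi> \<psi>"
    then have "(unit_retraction \<psi> \<cdot> k) \<cdot> a \<in> Iso C (unit_of \<phi>) (unit_of \<psi>)"
      by (simp add: incident_def eq)
    then have act: "unit_retraction \<psi> \<cdot> k \<in> Act C"
      by (rule split_epi_active[rotated 2]) (simp_all add: Hom_def)
    obtain v where v: "v \<in> Inert C" "v \<in> Mor C" "Dom C v = unit_of \<psi>" "Cod C v = Dom C k"
        "(unit_retraction \<psi> \<cdot> k) \<cdot> v = Id C (unit_of \<psi>)"
      using unit_section_exists[OF t(4) act] by auto
    \<comment> \<open>Both sides are inert sections of the active map
      \<open>unit_retraction \<psi>\<close> to a unit.\<close>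
    have "unit_inclusion \<psi> = k \<cdot> v"
      using v t k by - (rule unit_section_unique[OF t(4,6)], simp_all add: Inert_Comp)
    then show "\<exists>t \<in> Inert C. Dom C t = unit_of \<psi> \<and> Cod C t = Dom C k \<and> unit_inclusion \<psi> = k \<cdot> t"
      using v by blast
  next
    assume "\<exists>t \<in> Inert C. Dom C t = unit_of \<psi> \<and> Cod C t = Dom C k \<and> unit_inclusion \<psi> = k \<cdot> t"
    then obtain v where v: "v \<in> Inert C" "Dom C v = unit_of \<psi>" "Cod C v = Dom C k"
        "unit_inclusion \<psi> = k \<cdot> v"
      by blast
    obtain q where q: "active_retraction C v q" "q \<in> Act C" "q \<in> Mor C" "Dom C q = Dom C k"
        "Cod C q = unit_of \<psi>"
      using retraction_exists[OF v(1)] v by metis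
    obtain r where r: "active_retraction C k r" "r \<in> Mor C" "Dom C r = B" "Cod C r = Dom C k"
        "r \<cdot> k = Id C (Dom C k)"
      using retraction_exists[OF k] by auto
    have "unit_retraction \<psi> = q \<cdot> r"
      using retraction_Comp[OF q(1) v(1) r(1) k v(3)] v(4) retraction_unique[OF t(1,5)] by simp
    then have "unit_retraction \<psi> \<cdot> (f \<cdot> unit_inclusion \<phi>) = q \<cdot> a"
      using q r by (simp add: eq Comp_cancel)
    also have "\<dots> \<in> Iso C (unit_of \<phi>) (unit_of \<psi>)"
      using q a by (intro active_between_units_Iso s t) (simp_all add: Act_Comp)
    finally show "incident f \<phi> \<psi>"
      by (simp add: incident_def)
  qed
qed

text \<open>Factor \<open>f\<close> on the unit of \<open>\<phi>\<close> as \<open>k\<close> after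
  \<open>a\<close>, and let \<open>x\<close> be the retraction of \<open>\<omega>\<close> after
  \<open>g\<close>. Either side of the equivalence makes \<open>x \<cdot> k\<close> a split
  epimorphism, hence active. From left to right its inert section gives the intermediate moment;
  from right to left \<open>(x \<cdot> k) \<cdot> a\<close> becomes an active map between
  units.\<close>

lemma incident_Comp:
  assumes f: "f \<in> Hom C A B" and g: "g \<in> Hom C B D"
    and \<phi>: "\<phi> \<in> elementary_moments C A" and \<omega>: "\<omega> \<in> elementary_moments C D"
  shows "incident (g \<cdot> f) \<phi> \<omega> \<longleftrightarrow>
    (\<exists>\<psi> \<in> elementary_moments C B. incident f \<phi> \<psi> \<and> incident g \<psi> \<omega>)"
proof -
  note s = elementary_splitting[OF \<phi>] and t = elementary_splitting[OF \<omega>]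
  have fg [simp]: "f \<in> Mor C" "Dom C f = A" "Cod C f = B" "g \<in> Mor C" "Dom C g = B" "Cod C g = D"
    using f g by (auto simp: Hom_def)
  note [simp] = s(2,3) t(2,3,7,8,9)
  obtain a k where a: "a \<in> Act C" and k: "k \<in> Inert C" and c: "Cod C a = Dom C k"
      and eq: "f \<cdot> unit_inclusion \<phi> = k \<cdot> a"
    using factorisation[of "f \<cdot> unit_inclusion \<phi>"] by auto
  note [simp] = Act_Mor[OF a] Inert_Mor[OF k] c
  have "Dom C (k \<cdot> a) = unit_of \<phi>" "Cod C (k \<cdot> a) = B"
    unfolding eq[symmetric] by simp_all
  then have [simp]: "Dom C a = unit_of \<phi>" "Cod C k = B"
    by simp_all
  define x where "x = unit_retraction \<omega> \<cdot> g"
  have x [simp]: "x \<in> Mor C" "Dom C x = B" "Cod C x = unit_of \<omega>"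
    by (simp_all add: x_def)
  have gf: "incident (g \<cdot> f) \<phi> \<omega> \<longleftrightarrow> (x \<cdot> k) \<cdot> a \<in> Iso C (unit_of \<phi>) (unit_of \<omega>)"
    by (simp add: incident_def x_def eq)
  show ?thesis
  proof
    assume "incident (g \<cdot> f) \<phi> \<omega>"
    then have "(x \<cdot> k) \<cdot> a \<in> Iso C (unit_of \<phi>) (unit_of \<omega>)"
      using gf by blast
    then have act: "x \<cdot> k \<in> Act C"
      by (rule split_epi_active[rotated 2]) (simp_all add: Hom_def)
    obtain v where v: "v \<in> Inert C" "v \<in> Mor C" "Dom C v = unit_of \<omega>" "Cod C v = Dom C k"
        "(x \<cdot> k) \<cdot> v = Id C (unit_of \<omega>)"
      using unit_section_exists[OF t(4) act] by auto
    \<comment> \<open>The intermediate moment comes from the inert map \<open>k \<cdot> v\<close> of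
      a unit into \<open>B\<close>.\<close>
    obtain \<psi> h where \<psi>: "\<psi> \<in> elementary_moments C B" and h: "h \<in> Iso C (unit_of \<psi>) (unit_of \<omega>)"
      and inc: "unit_inclusion \<psi> = (k \<cdot> v) \<cdot> h"
      using elementary_of_inert[OF Inert_Comp[OF v(1) k v(4)]] v t(4) by auto
    note h' = Iso_arrow[OF h]
    have "incident f \<phi> \<psi>"
      unfolding incident_iff_factors[OF f \<phi> \<psi> a k c eq]
      using v h' inc by (intro bexI[of _ "v \<cdot> h"]) (simp_all add: Inert_Comp Iso_Inert[OF h])
    moreover have "x \<cdot> unit_inclusion \<psi> = ((x \<cdot> k) \<cdot> v) \<cdot> h"
      using v(1-4) h' inc by simp
    then have "x \<cdot> unit_inclusion \<psi> = h"
      using h' by (simp only: v(5)) simp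
    then have "incident g \<psi> \<omega>"
      using elementary_splitting[OF \<psi>] h by (simp add: incident_def x_def)
    ultimately show "\<exists>\<psi> \<in> elementary_moments C B. incident f \<phi> \<psi> \<and> incident g \<psi> \<omega>"
      using \<psi> by blast
  next
    assume "\<exists>\<psi> \<in> elementary_moments C B. incident f \<phi> \<psi> \<and> incident g \<psi> \<omega>"
    then obtain \<psi> where \<psi>: "\<psi> \<in> elementary_moments C B" and i: "incident f \<phi> \<psi>" "incident g \<psi> \<omega>"
      by blast
    obtain v where v: "v \<in> Inert C" "Dom C v = unit_of \<psi>" "Cod C v = Dom C k"
        "unit_inclusion \<psi> = k \<cdot> v"
      using i(1) incident_iff_factors[OF f \<phi> \<psi> a k c eq] by blast
    note [simp] = Inert_Mor[OF v(1)]
    have "(x \<cdot> k) \<cdot> v \<in> Iso C (unit_of \<psi>) (unit_of \<omega>)"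
      using i(2) v by (simp add: incident_def x_def)
    then have act: "x \<cdot> k \<in> Act C"
      by (rule split_epi_active[rotated 2]) (simp_all add: Hom_def v)
    have "(x \<cdot> k) \<cdot> a \<in> Act C"
      using Act_Comp[OF a act] by simp
    then show "incident (g \<cdot> f) \<phi> \<omega>"
      unfolding gf by (intro active_between_units_Iso s t) simp_all
  qed
qed

text \<open>Here \<open>f \<cdot> unit_inclusion \<phi>\<close> is inert, so it is its own inert
  part, with an identity as active part. The factor through it is an inert map between units, hence
  invertible.\<close>

lemma incident_inert_iff:
  assumes f: "f \<in> Inert C" "f \<in> Hom C A B" and \<phi>: "\<phi> \<in> elementary_moments C A"
    and \<psi>: "\<psi> \<in> elementary_moments C B"
  shows "incident f \<phi> \<psi> \<longleftrightarrow>
    (\<exists>h \<in> Iso C (unit_of \<psi>) (unit_of \<phi>). unit_inclusion \<psi> = f \<cdot> (unit_inclusion \<phi> \<cdot> h))"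
proof -
  note s = elementary_splitting[OF \<phi>] and t = elementary_splitting[OF \<psi>]
  have [simp]: "f \<in> Mor C" "Dom C f = A" "Cod C f = B"
    using f by (auto simp: Hom_def)
  note [simp] = s(2,3)
  have U: "unit_of \<phi> \<in> Obj C"
    using unit_Obj s(4) by blast
  have "incident f \<phi> \<psi> \<longleftrightarrow> (\<exists>h \<in> Inert C. Dom C h = unit_of \<psi> \<and>
      Cod C h = Dom C (f \<cdot> unit_inclusion \<phi>) \<and> unit_inclusion \<psi> = (f \<cdot> unit_inclusion \<phi>) \<cdot> h)"
    using U f(1) s(1)
    by (intro incident_iff_factors[OF f(2) \<phi> \<psi> Iso_Act[OF Id_Iso[OF U]]]) (simp_all add: Inert_Comp)
  also have "\<dots> \<longleftrightarrow> (\<exists>h \<in> Iso C (unit_of \<psi>) (unit_of \<phi>).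
      unit_inclusion \<psi> = f \<cdot> (unit_inclusion \<phi> \<cdot> h))"
    using inert_between_units_Iso[OF t(4) s(4)] Iso_Inert Iso_arrow Inert_Mor
    by (fastforce simp: Bex_def)
  finally show ?thesis .
qed

lemma incident_Id_iff:
  assumes \<phi>: "\<phi> \<in> elementary_moments C A" and \<psi>: "\<psi> \<in> elementary_moments C A"
  shows "incident (Id C A) \<phi> \<psi> \<longleftrightarrow> \<phi> = \<psi>"
proof -
  note s = elementary_splitting[OF \<phi>]
  have A: "A \<in> Obj C"
    using elementary_Obj[OF \<phi>] .
  have *: "incident (Id C A) \<phi> \<psi> \<longleftrightarrow>
      (\<exists>h \<in> Iso C (unit_of \<psi>) (unit_of \<phi>). unit_inclusion \<psi> = Id C A \<cdot> (unit_inclusion \<phi> \<cdot> h))"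
    using incident_inert_iff[OF Iso_Inert[OF Id_Iso] Id_in_Hom \<phi> \<psi>] A by simp
  also have "\<dots> \<longleftrightarrow> (\<exists>h \<in> Iso C (unit_of \<psi>) (unit_of \<phi>). unit_inclusion \<psi> = unit_inclusion \<phi> \<cdot> h)"
    using s Iso_arrow by (intro bex_cong) auto
  also have "\<dots> \<longleftrightarrow> \<phi> = \<psi>"
  proof
    assume "\<phi> = \<psi>"
    then show "\<exists>h \<in> Iso C (unit_of \<psi>) (unit_of \<phi>). unit_inclusion \<psi> = unit_inclusion \<phi> \<cdot> h"
      using Id_Iso[OF unit_Obj[OF s(4)]] s(2) by (intro bexI[of _ "Id C (unit_of \<phi>)"]) simp_all
  qed (use elementary_eqI[OF \<psi> \<phi>] in blast)
  finally show ?thesis .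
qed

text \<open>This becomes the disjointness of the entries of a tuple. The map \<open>x\<close> from
  \<open>A\<close> to the unit of \<open>\<psi>\<close> is a split epimorphism, hence active, and
  both inclusions, corrected by isomorphisms, are inert sections of it. By (U2) they
  coincide.\<close>

lemma incident_unique_source:
  assumes f: "f \<in> Hom C A B"
    and \<phi>: "\<phi> \<in> elementary_moments C A" "incident f \<phi> \<psi>"
    and \<phi>': "\<phi>' \<in> elementary_moments C A" "incident f \<phi>' \<psi>"
    and \<psi>: "\<psi> \<in> elementary_moments C B"
  shows "\<phi> = \<phi>'"
proof -
  note s = elementary_splitting[OF \<phi>(1)] and s' = elementary_splitting[OF \<phi>'(1)]
    and t = elementary_splitting[OF \<psi>]
  have [simp]: "f \<in> Mor C" "Dom C f = A" "Cod C f = B"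
    using f by (auto simp: Hom_def)
  note [simp] = s(2,3) s'(2,3) t(2,3,7,8,9)
  define x where "x = unit_retraction \<psi> \<cdot> f"
  have x [simp]: "x \<in> Mor C" "Dom C x = A" "Cod C x = unit_of \<psi>"
    by (simp_all add: x_def)
  have i: "x \<cdot> unit_inclusion \<phi> \<in> Iso C (unit_of \<phi>) (unit_of \<psi>)"
    and i': "x \<cdot> unit_inclusion \<phi>' \<in> Iso C (unit_of \<phi>') (unit_of \<psi>)"
    using \<phi>(2) \<phi>'(2) by (simp_all add: incident_def x_def)
  have act: "x \<in> Act C"
    by (rule split_epi_active[OF _ _ i]) (simp_all add: Hom_def)
  obtain h where h: "h \<in> Iso C (unit_of \<psi>) (unit_of \<phi>)"
    "(x \<cdot> unit_inclusion \<phi>) \<cdot> h = Id C (unit_of \<psi>)" "h \<cdot> (x \<cdot> unit_inclusion \<phi>) = Id C (unit_of \<phi>)"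
    using Iso_inverse[OF i] by metis
  obtain h' where h': "h' \<in> Iso C (unit_of \<psi>) (unit_of \<phi>')"
    "(x \<cdot> unit_inclusion \<phi>') \<cdot> h' = Id C (unit_of \<psi>)"
    using Iso_inverse[OF i'] by metis
  note [simp] = Iso_arrow[OF h(1)] Iso_arrow[OF h'(1)]
  have "unit_inclusion \<phi> \<cdot> h = unit_inclusion \<phi>' \<cdot> h'"
    using h(2) h'(2) s(1) s'(1) Iso_Inert[OF h(1)] Iso_Inert[OF h'(1)]
    by - (rule unit_section_unique[OF t(4) act], simp_all add: Inert_Comp)
  then have "(unit_inclusion \<phi> \<cdot> h) \<cdot> (x \<cdot> unit_inclusion \<phi>) =
      (unit_inclusion \<phi>' \<cdot> h') \<cdot> (x \<cdot> unit_inclusion \<phi>)"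
    by simp
  then have "unit_inclusion \<phi> = unit_inclusion \<phi>' \<cdot> (h' \<cdot> (x \<cdot> unit_inclusion \<phi>))"
    using h(3) by simp
  then show ?thesis
    using elementary_eqI[OF \<phi>(1) \<phi>'(1) Iso_Comp[OF i h'(1)]] by blast
qed

text \<open>This becomes the covering condition for active tuples. The composite of \<open>f\<close>
  with the retraction of \<open>\<psi>\<close> is an active map to a unit, and its inert section
  gives the moment of the source.\<close>

lemma incident_active_source:
  assumes f: "f \<in> Act C" "f \<in> Hom C A B" and \<psi>: "\<psi> \<in> elementary_moments C B"
  obtains \<phi> where "\<phi> \<in> elementary_moments C A" "incident f \<phi> \<psi>"
proof -
  note t = elementary_splitting[OF \<psi>]
  have [simp]: "f \<in> Mor C" "Dom C f = A" "Cod C f = B"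
    using f by (auto simp: Hom_def)
  note [simp] = t(2,3,7,8,9)
  have act: "unit_retraction \<psi> \<cdot> f \<in> Act C"
    using f t by (simp add: Act_Comp)
  obtain v where v: "v \<in> Inert C" "v \<in> Mor C" "Dom C v = unit_of \<psi>" "Cod C v = A"
      "(unit_retraction \<psi> \<cdot> f) \<cdot> v = Id C (unit_of \<psi>)"
    using unit_section_exists[OF t(4) act] by auto
  obtain \<phi> h where \<phi>: "\<phi> \<in> elementary_moments C A" and h: "h \<in> Iso C (unit_of \<phi>) (unit_of \<psi>)"
    and inc: "unit_inclusion \<phi> = v \<cdot> h"
    using elementary_of_inert[OF v(1)] v t(4) by auto
  note [simp] = Iso_arrow[OF h]
  have "unit_retraction \<psi> \<cdot> (f \<cdot> unit_inclusion \<phi>) = ((unit_retraction \<psi> \<cdot> f) \<cdot> v) \<cdot> h"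
    using v(1-4) inc by simp
  also have "\<dots> = h"
    unfolding v(5) by simp
  finally show ?thesis
    using that[OF \<phi>] h by (simp add: incident_def)
qed

text \<open>This becomes the singleton condition for inert tuples. The inert map
  \<open>f \<cdot> unit_inclusion \<phi>\<close> starts at a unit and so gives a moment of
  \<open>B\<close>. Any other incident moment has the same inclusion up to an isomorphism of
  units.\<close>

lemma incident_inert_target:
  assumes f: "f \<in> Inert C" "f \<in> Hom C A B" and \<phi>: "\<phi> \<in> elementary_moments C A"
  shows "\<exists>!\<psi>. \<psi> \<in> elementary_moments C B \<and> incident f \<phi> \<psi>"
proof -
  note s = elementary_splitting[OF \<phi>]
  have [simp]: "f \<in> Mor C" "Dom C f = A" "Cod C f = B"
    using f by (auto simp: Hom_def)
  note [simp] = s(2,3)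
  obtain \<psi> h where \<psi>: "\<psi> \<in> elementary_moments C B" and h: "h \<in> Iso C (unit_of \<psi>) (unit_of \<phi>)"
    and inc: "unit_inclusion \<psi> = (f \<cdot> unit_inclusion \<phi>) \<cdot> h"
    using elementary_of_inert[OF Inert_Comp[OF s(1) f(1)]] s(4) by auto
  note h' [simp] = Iso_arrow[OF h]
  have "incident f \<phi> \<psi>"
    using incident_inert_iff[OF f \<phi> \<psi>] h inc by auto
  moreover have "\<omega> = \<psi>" if \<omega>: "\<omega> \<in> elementary_moments C B" "incident f \<phi> \<omega>" for \<omega>
  proof -
    obtain g where g: "g \<in> Iso C (unit_of \<omega>) (unit_of \<phi>)"
      "unit_inclusion \<omega> = f \<cdot> (unit_inclusion \<phi> \<cdot> g)"
      using incident_inert_iff[OF f \<phi> \<omega>(1)] \<omega>(2) by blast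
    obtain h1 where h1: "h1 \<in> Iso C (unit_of \<phi>) (unit_of \<psi>)" "h \<cdot> h1 = Id C (unit_of \<phi>)"
      using Iso_inverse[OF h] by metis
    note [simp] = Iso_arrow[OF g(1)] Iso_arrow[OF h1(1)]
    have "unit_inclusion \<omega> = unit_inclusion \<psi> \<cdot> (h1 \<cdot> g)"
      using g(2) h1(2) inc by (simp add: Comp_cancel)
    then show ?thesis
      using elementary_eqI[OF \<omega>(1) \<psi> Iso_Comp[OF g(1) h1(1)]] by blast
  qed
  ultimately show ?thesis
    using \<psi> by blast
qed

text \<open>The identity of \<open>U\<close> gives one elementary moment. All inclusions into
  \<open>U\<close> are inert maps between units, hence isomorphisms, so they differ from each other
  by isomorphisms of units.\<close>

lemma unit_elementary_moments:
  assumes U: "unit_object C U"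
  obtains \<phi> where "elementary_moments C U = {\<phi>}"
proof -
  have I: "Id C U \<in> Inert C" "Cod C (Id C U) = U" "unit_object C (Dom C (Id C U))"
    using U unit_Obj[OF U] Iso_Inert[OF Id_Iso] by simp_all
  obtain \<phi> where \<phi>: "\<phi> \<in> elementary_moments C U"
    using elementary_of_inert[OF I] by blast
  have "\<psi> = \<phi>" if \<psi>: "\<psi> \<in> elementary_moments C U" for \<psi>
  proof -
    note s = elementary_splitting[OF \<phi>] and t = elementary_splitting[OF \<psi>]
    have i: "unit_inclusion \<phi> \<in> Iso C (unit_of \<phi>) U" and j: "unit_inclusion \<psi> \<in> Iso C (unit_of \<psi>) U"
      using s t inert_between_units_Iso U by auto
    obtain g where g: "g \<in> Iso C U (unit_of \<phi>)" "unit_inclusion \<phi> \<cdot> g = Id C U"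
      using Iso_inverse[OF i] by metis
    have "unit_inclusion \<psi> = unit_inclusion \<phi> \<cdot> (g \<cdot> unit_inclusion \<psi>)"
      using s t Iso_arrow[OF g(1)] g(2) by (simp add: Comp_cancel)
    then show ?thesis
      using elementary_eqI[OF \<psi> \<phi> Iso_Comp[OF j g(1)]] by blast
  qed
  then show ?thesis
    using that[of \<phi>] \<phi> by blast
qed

end

section \<open>Morphisms and elementary moments of Segal's category\<close>

declare One_nat_def [simp del]

definition component :: "gamma_mor \<Rightarrow> nat \<Rightarrow> nat set" where
  "component x p = fst (snd x) p"

lemma component_Pair [simp]: "component (m, N, n) p = N p"
  by (simp add: component_def)

text \<open>Since tuples are empty outside their index range, disjointness can be quantified over
  all indices, which spares range conditions in later proofs.\<close>

lemma Hom_Gamma_iff: "(k, N, l) \<in> Hom Gamma m n \<longleftrightarrow> k = m \<and> l = n \<and>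
    (\<forall>p \<in> {1..m}. N p \<subseteq> {1..n}) \<and> (\<forall>p q j. j \<in> N p \<longrightarrow> j \<in> N q \<longrightarrow> p = q) \<and>
    (\<forall>p. p \<notin> {1..m} \<longrightarrow> N p = {})"
proof -
  have "disjoint_family_on N {1..m} \<longleftrightarrow> (\<forall>p q j. j \<in> N p \<longrightarrow> j \<in> N q \<longrightarrow> p = q)"
    if "\<forall>p. p \<notin> {1..m} \<longrightarrow> N p = {}"
    using that unfolding disjoint_family_on_def by blast
  then show ?thesis
    by (auto simp: Hom_def Gamma_def gamma_mors_def)
qed

lemma Hom_GammaE:
  assumes "x \<in> Hom Gamma m n"
  obtains N where "x = (m, N, n)"
  using assms by (cases x) (simp add: Hom_Gamma_iff)

lemma component_range:
  assumes "x \<in> Hom Gamma m n" "j \<in> component x p"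
  shows "p \<in> {1..m} \<and> j \<in> {1..n}"
proof -
  obtain N where x: "x = (m, N, n)"
    using assms(1) by (rule Hom_GammaE)
  show ?thesis
    using assms unfolding x Hom_Gamma_iff component_Pair by blast
qed

lemma component_disjoint:
  assumes "x \<in> Hom Gamma m n" "j \<in> component x p" "j \<in> component x q"
  shows "p = q"
proof -
  obtain N where x: "x = (m, N, n)"
    using assms(1) by (rule Hom_GammaE)
  show ?thesis
    using assms unfolding x Hom_Gamma_iff component_Pair by blast
qed

lemma Gamma_eqI:
  assumes "x \<in> Hom Gamma m n" "y \<in> Hom Gamma m n" "\<And>p. p \<in> {1..m} \<Longrightarrow> component x p = component y p"
  shows "x = y"
proof -
  obtain N where x: "x = (m, N, n)"
    using assms(1) by (rule Hom_GammaE)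
  obtain M where y: "y = (m, M, n)"
    using assms(2) by (rule Hom_GammaE)
  have "N p = M p" for p
  proof (cases "p \<in> {1..m}")
    case True
    then show ?thesis
      using assms(3) by (simp add: x y)
  next
    case False
    then show ?thesis
      using assms(1,2) unfolding x y Hom_Gamma_iff by blast
  qed
  then show ?thesis
    by (simp add: x y ext)
qed

lemma Gamma_HomI:
  assumes "\<And>p j. j \<in> N p \<Longrightarrow> p \<in> {1..m} \<and> j \<in> {1..n}"
    and "\<And>p q j. j \<in> N p \<Longrightarrow> j \<in> N q \<Longrightarrow> p = q"
  shows "(m, N, n) \<in> Hom Gamma m n"
  unfolding Hom_Gamma_iff using assms by blast

lemma component_Comp [simp]: "component (Comp Gamma y x) p = (\<Union>j \<in> component x p. component y j)"
  by (cases x; cases y) (simp add: Gamma_def)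

lemma component_Id [simp]: "component (Id Gamma n) p = (if p \<in> {1..n} then {p} else {})"
  by (simp add: Gamma_def)

lemma Id_Gamma_Hom: "Id Gamma n \<in> Hom Gamma n n"
proof -
  have "(n, \<lambda>p. if p \<in> {1..n} then {p} else {}, n) \<in> Hom Gamma n n"
    by (rule Gamma_HomI) (auto split: if_splits)
  moreover have "Id Gamma n = (n, \<lambda>p. if p \<in> {1..n} then {p} else {}, n)"
    by (simp add: Gamma_def)
  ultimately show ?thesis
    by (simp only:)
qed

lemma Comp_Gamma_Hom:
  assumes x: "x \<in> Hom Gamma k m" and y: "y \<in> Hom Gamma m n"
  shows "Comp Gamma y x \<in> Hom Gamma k n"
proof -
  obtain N where N: "x = (k, N, m)"
    using x by (rule Hom_GammaE)
  obtain M where M: "y = (m, M, n)"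
    using y by (rule Hom_GammaE)
  have c: "Comp Gamma y x = (k, \<lambda>i. \<Union>j \<in> component x i. component y j, n)"
    by (simp add: Gamma_def N M)
  show ?thesis
    unfolding c
    by (rule Gamma_HomI)
      (use component_range[OF x] component_range[OF y] component_disjoint[OF x] component_disjoint[OF y]
       in blast)+
qed

lemma Act_Gamma_iff:
  assumes x: "x \<in> Hom Gamma m n"
  shows "x \<in> Act Gamma \<longleftrightarrow> (\<forall>j \<in> {1..n}. \<exists>p. j \<in> component x p)"
proof -
  obtain N where N: "x = (m, N, n)"
    using x by (rule Hom_GammaE)
  have "x \<in> gamma_mors"
    using x by (simp add: Hom_def Gamma_def)
  then have "x \<in> Act Gamma \<longleftrightarrow> (\<Union>p \<in> {1..m}. component x p) = {1..n}"
    by (simp add: Gamma_def N)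
  then show ?thesis
    using component_range[OF x] by blast
qed

lemma Inert_Gamma_iff:
  assumes x: "x \<in> Hom Gamma m n"
  shows "x \<in> Inert Gamma \<longleftrightarrow> (\<forall>p \<in> {1..m}. \<exists>j. component x p = {j})"
proof -
  obtain N where N: "x = (m, N, n)"
    using x by (rule Hom_GammaE)
  have "x \<in> gamma_mors"
    using x by (simp add: Hom_def Gamma_def)
  then show ?thesis
    by (simp add: Gamma_def N is_singleton_def)
qed

section \<open>Units and elementary moments of Gamma\<close>

lemma unit_object_Gamma_le:
  assumes "unit_object Gamma n"
  shows "n \<le> 1"
proof (rule ccontr)
  assume n: "\<not> n \<le> 1"
  \<comment> \<open>The active map whose only entry is the whole of \<open>{1..n}\<close> violates
    (U2): the first entry of an inert section would be \<open>{1}\<close>, so the composite would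
    have \<open>{1..n}\<close> as first entry where the identity has \<open>{1}\<close>.\<close>
  define r where "r = (1::nat, \<lambda>p. if p = (1::nat) then {1..n} else {}, n)"
  have r: "r \<in> Hom Gamma 1 n"
    unfolding r_def by (rule Gamma_HomI) (auto split: if_splits)
  have "\<forall>j \<in> {1..n}. \<exists>p. j \<in> component r p"
    by (auto simp: r_def)
  then have "r \<in> Act Gamma" "Cod Gamma r = n"
    using Act_Gamma_iff[OF r] by (simp_all add: r_def Gamma_def)
  then obtain i where "inert_section Gamma r i"
    using assms unfolding unit_object_def by blast
  then have i: "i \<in> Inert Gamma" "i \<in> Hom Gamma n 1" and ri: "Comp Gamma r i = Id Gamma n"
    using r by (auto simp: inert_section_def Hom_def)
  obtain j where j: "component i 1 = {j}"
    using i n Inert_Gamma_iff[OF i(2)] by force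
  then have "j = 1"
    using component_range[OF i(2), of j 1] by auto
  then have "component (Comp Gamma r i) 1 = {1..n}"
    using j by (simp add: r_def)
  moreover have "component (Comp Gamma r i) 1 = {1}"
    unfolding ri using n by simp
  moreover have "2 \<in> {1..n}"
    using n by simp
  ultimately show False
    by simp
qed

text \<open>The only endomorphism of 0 is the empty tuple, so 0 has no moment besides the
  identity.\<close>

lemma unit_object_Gamma_pos:
  assumes "unit_object Gamma n"
  shows "n \<noteq> 0"
proof
  assume n: "n = 0"
  obtain \<phi> where \<phi>: "\<phi> \<in> moments Gamma n" "\<phi> \<noteq> Id Gamma n"
    using assms unfolding unit_object_def primitive_object_def by blast
  then have "\<phi> \<in> Hom Gamma n n"
    by (simp add: moments_def)
  then have "\<phi> = Id Gamma n"
    by (rule Gamma_eqI[OF _ Id_Gamma_Hom]) (simp add: n)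
  then show False
    using \<phi> by simp
qed

text \<open>Besides the identity, the object 1 has a single endomorphism \<open>z\<close>, with
  empty entry, which splits over 0; thus congruence is trivial. For (U2), an active map to 1 has
  exactly one non-empty entry, and an inert section has to select its index.\<close>

lemma unit_object_Gamma_1: "unit_object Gamma 1"
proof -
  define z where "z = (1::nat, \<lambda>p::nat. {} :: nat set, 1::nat)"
  have z: "z \<in> Hom Gamma 1 1"
    unfolding z_def by (rule Gamma_HomI) auto
  have z_unique: "\<phi> = z" if "\<phi> \<in> moments Gamma 1 - {Id Gamma 1}" for \<phi>
  proof -
    have \<phi>: "\<phi> \<in> Hom Gamma 1 1" "\<phi> \<noteq> Id Gamma 1"
      using that by (auto simp: moments_def)
    have "component \<phi> 1 \<noteq> {1}"
    proof
      assume "component \<phi> 1 = {1}"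
      then have "\<phi> = Id Gamma 1"
        by (intro Gamma_eqI[OF \<phi>(1) Id_Gamma_Hom]) simp
      with \<phi>(2) show False ..
    qed
    moreover have "component \<phi> 1 \<subseteq> {1..1}"
      using component_range[OF \<phi>(1)] by blast
    ultimately have "component \<phi> 1 = {}"
      by (simp add: subset_singleton_iff)
    then show ?thesis
      by (intro Gamma_eqI[OF \<phi>(1) z]) (simp add: z_def)
  qed
  have "congruent_moments Gamma z z"
    by (simp add: congruent_moments_def z_def Gamma_def)
  moreover have "z \<in> moments Gamma 1 - {Id Gamma 1}"
  proof -
    define a where "a = (1::nat, \<lambda>p::nat. {} :: nat set, 0::nat)"
    define i where "i = (0::nat, \<lambda>p::nat. {} :: nat set, 1::nat)"
    have a: "a \<in> Hom Gamma 1 0" and i: "i \<in> Hom Gamma 0 1"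
      unfolding a_def i_def by (rule Gamma_HomI; auto)+
    have "a \<in> Act Gamma" "i \<in> Inert Gamma"
      by (simp_all add: Act_Gamma_iff[OF a] Inert_Gamma_iff[OF i])
    moreover have "z = Comp Gamma i a"
      using z Comp_Gamma_Hom[OF a i] by (rule Gamma_eqI) (simp add: z_def a_def)
    moreover have "Comp Gamma a i = Id Gamma 0"
      using Comp_Gamma_Hom[OF i a] Id_Gamma_Hom by (rule Gamma_eqI) simp
    ultimately have "splits_over Gamma 1 z 0"
      using a i unfolding splits_over_def by blast
    moreover have "component z 1 \<noteq> component (Id Gamma 1) 1"
      by (simp add: z_def)
    ultimately show ?thesis
      using z by (auto simp: moments_def Gamma_def)
  qed
  moreover have "1 \<in> Obj Gamma"
    by (simp add: Gamma_def)
  ultimately have "primitive_object Gamma 1"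
    unfolding primitive_object_def using z_unique by (metis empty_iff)
  moreover have "\<exists>!i. inert_section Gamma r i" if r: "r \<in> Act Gamma" "Cod Gamma r = 1" for r
  proof -
    define m where "m = Dom Gamma r"
    have "Act Gamma \<subseteq> Mor Gamma"
      by (auto simp: Gamma_def)
    then have m: "r \<in> Hom Gamma m 1"
      using r by (auto simp: Hom_def m_def)
    obtain p where p: "1 \<in> component r p"
      using r(1) unfolding Act_Gamma_iff[OF m] by auto
    moreover have "component r p \<subseteq> {1..1}"
      using component_range[OF m] by blast
    ultimately have p': "p \<in> {1..m}" "component r p = {1}"
      using component_range[OF m p] by (auto simp: subset_singleton_iff)
    define s where "s = (1::nat, \<lambda>q. if q = (1::nat) then {p} else {}, m)"
    have s: "s \<in> Hom Gamma 1 m"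
      unfolding s_def using p' by (intro Gamma_HomI) (auto split: if_splits)
    have "s \<in> Inert Gamma"
      unfolding Inert_Gamma_iff[OF s] by (simp add: s_def)
    moreover have "Comp Gamma r s = Id Gamma 1"
      using Comp_Gamma_Hom[OF s m] Id_Gamma_Hom by (rule Gamma_eqI) (simp add: s_def p')
    ultimately have "inert_section Gamma r s"
      using s m by (auto simp: inert_section_def Hom_def)
    moreover have "t = s" if t: "inert_section Gamma r t" for t
    proof -
      have t': "t \<in> Inert Gamma" "t \<in> Hom Gamma 1 m" "Comp Gamma r t = Id Gamma 1"
        using t m by (auto simp: inert_section_def Hom_def)
      obtain q where q: "component t 1 = {q}"
        using t'(1) unfolding Inert_Gamma_iff[OF t'(2)] by auto
      have "component (Comp Gamma r t) 1 = {1}"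
        unfolding t'(3) by simp
      then have "1 \<in> component r q"
        using q by simp
      then have "q = p"
        using component_disjoint[OF m] p by blast
      then show ?thesis
        using q by (intro Gamma_eqI[OF t'(2) s]) (simp add: s_def)
    qed
    ultimately show ?thesis
      by blast
  qed
  ultimately show ?thesis
    unfolding unit_object_def by blast
qed

lemma unit_object_Gamma_iff: "unit_object Gamma n \<longleftrightarrow> n = 1"
  using unit_object_Gamma_le unit_object_Gamma_pos unit_object_Gamma_1
  by (metis le_antisym less_one linorder_not_less)

text \<open>The inert part of a splitting over 1 selects an index \<open>p\<close>. The section
  equation makes the \<open>p\<close>-th entry of the active part \<open>{1}\<close>, and
  disjointness empties all its other entries.\<close>

lemma elementary_moments_Gamma:
  "elementary_moments Gamma n = (\<lambda>p. (n, \<lambda>q. if q = p then {p} else {}, n)) ` {1..n}"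
proof (intro equalityI subsetI)
  fix \<phi> assume "\<phi> \<in> elementary_moments Gamma n"
  then have \<phi>: "\<phi> \<in> Hom Gamma n n" "splits_over Gamma n \<phi> 1"
    by (auto simp: elementary_moments_def moments_def unit_object_Gamma_iff)
  then obtain a i where a: "a \<in> Hom Gamma n 1" and i: "i \<in> Inert Gamma" "i \<in> Hom Gamma 1 n"
    and eq: "\<phi> = Comp Gamma i a" "Comp Gamma a i = Id Gamma 1"
    unfolding splits_over_def by blast
  obtain p where p: "component i 1 = {p}"
    using i(1) unfolding Inert_Gamma_iff[OF i(2)] by auto
  then have pn: "p \<in> {1..n}"
    using component_range[OF i(2), of p 1] by simp
  have "component (Comp Gamma a i) 1 = {1}"
    unfolding eq by simp
  then have ap: "component a p = {1}"
    using p by simp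
  have aq: "component a q = {}" if "q \<noteq> p" for q
  proof -
    have "component a q \<subseteq> {1..1}"
      using component_range[OF a] by blast
    moreover have "1 \<notin> component a q"
      using component_disjoint[OF a, of 1 p q] ap that by blast
    ultimately show ?thesis
      by (auto simp: subset_singleton_iff)
  qed
  have "(n, \<lambda>q. if q = p then {p} else {}, n) \<in> Hom Gamma n n"
    using pn by (intro Gamma_HomI) (auto split: if_splits)
  with \<phi>(1) have "\<phi> = (n, \<lambda>q. if q = p then {p} else {}, n)"
    by (rule Gamma_eqI) (simp add: eq(1) ap aq p)
  then show "\<phi> \<in> (\<lambda>p. (n, \<lambda>q. if q = p then {p} else {}, n)) ` {1..n}"
    using pn by blast
next
  fix \<phi> assume "\<phi> \<in> (\<lambda>p. (n, \<lambda>q. if q = p then {p} else {}, n)) ` {1..n}"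
  then obtain p where p: "p \<in> {1..n}" "\<phi> = (n, \<lambda>q. if q = p then {p} else {}, n)"
    by blast
  have \<phi>: "\<phi> \<in> Hom Gamma n n"
    unfolding p(2) using p(1) by (intro Gamma_HomI) (auto split: if_splits)
  define a where "a = (n, \<lambda>q. if q = p then {1::nat} else {}, 1::nat)"
  define i where "i = (1::nat, \<lambda>q. if q = (1::nat) then {p} else {}, n)"
  have a: "a \<in> Hom Gamma n 1" and i: "i \<in> Hom Gamma 1 n"
    unfolding a_def i_def using p(1) by (intro Gamma_HomI; auto split: if_splits)+
  have "a \<in> Act Gamma" "i \<in> Inert Gamma"
    unfolding Act_Gamma_iff[OF a] Inert_Gamma_iff[OF i] using p(1) by (auto simp: a_def i_def)
  moreover have "\<phi> = Comp Gamma i a"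
    using \<phi> Comp_Gamma_Hom[OF a i] by (rule Gamma_eqI) (simp add: p(2) a_def i_def)
  moreover have "Comp Gamma a i = Id Gamma 1"
    using Comp_Gamma_Hom[OF i a] Id_Gamma_Hom by (rule Gamma_eqI) (simp add: a_def i_def)
  ultimately have "splits_over Gamma n \<phi> 1"
    using a i unfolding splits_over_def by blast
  then show "\<phi> \<in> elementary_moments Gamma n"
    using \<phi> unit_object_Gamma_1
    by (auto simp: elementary_moments_def moments_def Gamma_def)
qed

lemma elementary_moments_Gamma_eqpoll: "{1..n} \<approx> elementary_moments Gamma n"
proof -
  have "inj_on (\<lambda>p. (n, \<lambda>q. if q = p then {p} else {}, n)) {1..n}"
    by (rule inj_onI) (auto simp: fun_eq_iff split: if_splits)
  then show ?thesis
    unfolding elementary_moments_Gamma by (simp add: eqpoll_sym inj_on_image_eqpoll_self)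
qed

lemma Iso_GammaI:
  assumes b: "bij_betw b {1..m} {1..n}"
  shows "(m, \<lambda>p. if p \<in> {1..m} then {b p} else {}, n) \<in> Iso Gamma m n"
proof -
  define c where "c = the_inv_into {1..m} b"
  have c: "bij_betw c {1..n} {1..m}"
    unfolding c_def using b by (rule bij_betw_the_inv_into)
  have cb: "c (b p) = p" if "p \<in> {1..m}" for p
    using that b by (simp add: c_def bij_betw_def the_inv_into_f_f)
  have bc: "b (c q) = q" if "q \<in> {1..n}" for q
    using that b f_the_inv_into_f_bij_betw unfolding c_def by fast
  have Hom: "(k, \<lambda>p. if p \<in> {1..k} then {f p} else {}, l) \<in> Hom Gamma k l"
    if f: "bij_betw f {1..k} {1..l}" for f k l
    using bij_betwE[OF f] bij_betw_imp_inj_on[OF f]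
    by (intro Gamma_HomI) (auto split: if_splits dest: inj_onD)
  define x where "x = (m, \<lambda>p. if p \<in> {1..m} then {b p} else {}, n)"
  define y where "y = (n, \<lambda>p. if p \<in> {1..n} then {c p} else {}, m)"
  have x: "x \<in> Hom Gamma m n" and y: "y \<in> Hom Gamma n m"
    unfolding x_def y_def using Hom b c by blast+
  have "Comp Gamma y x = Id Gamma m"
    using Comp_Gamma_Hom[OF x y] Id_Gamma_Hom
    by (rule Gamma_eqI) (use cb bij_betwE[OF b] in \<open>auto simp: x_def y_def\<close>)
  moreover have "Comp Gamma x y = Id Gamma n"
    using Comp_Gamma_Hom[OF y x] Id_Gamma_Hom
    by (rule Gamma_eqI) (use bc bij_betwE[OF c] in \<open>auto simp: x_def y_def\<close>)
  ultimately show ?thesis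
    using x y unfolding x_def[symmetric] Iso_def by blast
qed

section \<open>Functors to Segal's category\<close>

context unital_moment_category
begin

text \<open>Incidence does not mention the functor, so only the numbering \<open>e\<close> can vary
  between two functors; this is what gives uniqueness.\<close>

lemma functor_to_Gamma_incidence:
  assumes F: "moment_functor C Gamma F" "cardinality_preserving C Gamma F" "unit_preserving C Gamma F"
  obtains e where "\<And>A. A \<in> Obj C \<Longrightarrow> bij_betw e (elementary_moments C A) {1..on_obj F A}"
    and "\<And>A B f \<phi>. f \<in> Hom C A B \<Longrightarrow> \<phi> \<in> elementary_moments C A \<Longrightarrow>
      component (on_mor F f) (e \<phi>) = e ` {\<psi> \<in> elementary_moments C B. incident f \<phi> \<psi>}"
proof -
  have FHom: "on_mor F f \<in> Hom Gamma (on_obj F A) (on_obj F B)" if "f \<in> Hom C A B" for f A B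
    using F(1) that by (auto simp: moment_functor_def is_functor_def Hom_def)
  have FId: "on_mor F (Id C A) = Id Gamma (on_obj F A)" if "A \<in> Obj C" for A
    using F(1) that by (auto simp: moment_functor_def is_functor_def)
  have FComp: "on_mor F (g \<cdot> f) = Comp Gamma (on_mor F g) (on_mor F f)"
    if "f \<in> Mor C" "g \<in> Mor C" "Cod C f = Dom C g" for f g
    using F(1) that by (auto simp: moment_functor_def is_functor_def)
  have FAct: "on_mor F f \<in> Act Gamma" if "f \<in> Act C" for f
    using F(1) that by (auto simp: moment_functor_def)
  have FInert: "on_mor F f \<in> Inert Gamma" if "f \<in> Inert C" for f
    using F(1) that by (auto simp: moment_functor_def)
  have Funit: "on_obj F U = 1" if "unit_object C U" for U
    using F(3) that unit_object_Gamma_iff by (auto simp: unit_preserving_def)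
  have Fcard: "elementary_moments C A \<approx> {1..on_obj F A}" if "A \<in> Obj C" for A
    using F(2) that elementary_moments_Gamma_eqpoll eqpoll_sym eqpoll_trans
    unfolding cardinality_preserving_def by blast

  have Iso_iff: "x \<in> Iso C U V \<longleftrightarrow> component (on_mor F x) 1 \<noteq> {}"
    if U: "unit_object C U" and V: "unit_object C V" and x: "x \<in> Hom C U V" for x U V
  proof
    assume "x \<in> Iso C U V"
    then obtain y where y: "y \<in> Iso C V U" "y \<cdot> x = Id C U"
      by (rule Iso_inverse)
    have "Comp Gamma (on_mor F y) (on_mor F x) = Id Gamma 1"
      using FComp[of x y] FId[OF unit_Obj[OF U]] Funit[OF U] y x Iso_arrow[OF y(1)]
      by (auto simp: Hom_def)
    then have "component (Comp Gamma (on_mor F y) (on_mor F x)) 1 = {1}"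
      by simp
    then show "component (on_mor F x) 1 \<noteq> {}"
      by auto
  next
    assume ne: "component (on_mor F x) 1 \<noteq> {}"
    have x' [simp]: "x \<in> Mor C" "Dom C x = U" "Cod C x = V"
      using x by (auto simp: Hom_def)
    obtain a m where a: "a \<in> Act C" and m: "m \<in> Inert C" and am: "Cod C a = Dom C m" "x = m \<cdot> a"
      using factorisation x' by blast
    note [simp] = Act_Mor[OF a] Inert_Mor[OF m]
    have d [simp]: "Cod C m = V" "Dom C a = U"
      using x' am by auto
    \<comment> \<open>The first entry of the image of \<open>x\<close> is a union indexed by the
      first entry of the image of \<open>a\<close>. The latter is thus a non-empty subset of
      \<open>{1..on_obj F (Dom C m)}\<close>, and preservation of cardinality yields an elementary
      moment of \<open>Dom C m\<close>.\<close>
    have "component (on_mor F a) 1 \<noteq> {}"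
      using ne am FComp[of a m] by auto
    then have "{1..on_obj F (Dom C m)} \<noteq> {}"
      using component_range[OF FHom[of a U "Dom C m"]] am by (fastforce simp: Hom_def)
    then have "elementary_moments C (Dom C m) \<noteq> {}"
      using Fcard[OF Dom_in_Obj[of m]] by (auto dest: eqpoll_sym)
    then obtain \<tau> where \<tau>: "\<tau> \<in> elementary_moments C (Dom C m)"
      by blast
    note t = elementary_splitting[OF \<tau>]
    \<comment> \<open>An inert map between units is invertible. Hence \<open>m\<close> is a split
      epimorphism, so it is active, and so is \<open>x\<close>.\<close>
    have "m \<cdot> unit_inclusion \<tau> \<in> Iso C (unit_of \<tau>) V"
      using t m by (intro inert_between_units_Iso V) (simp_all add: Inert_Comp)
    then have "m \<in> Act C"
      by (rule split_epi_active[rotated 2]) (use t in \<open>simp_all add: Hom_def\<close>)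
    then have "x \<in> Act C"
      using a am Act_Comp by blast
    then show "x \<in> Iso C U V"
      by (intro active_between_units_Iso U V) simp_all
  qed

  \<comment> \<open>The image of an inert map out of a unit is an inert map out of 1, that is, one
    singleton. A single function suffices for all objects because a moment determines its
    object.\<close>
  define e where "e \<phi> = the_elem (component (on_mor F (unit_inclusion \<phi>)) 1)" for \<phi>
  have e: "component (on_mor F (unit_inclusion \<phi>)) 1 = {e \<phi>}"
      "e \<phi> \<in> {1..on_obj F A}" if \<phi>: "\<phi> \<in> elementary_moments C A" for \<phi> A
  proof -
    note s = elementary_splitting[OF \<phi>]
    have h: "on_mor F (unit_inclusion \<phi>) \<in> Hom Gamma 1 (on_obj F A)"
      using FHom[of "unit_inclusion \<phi>" "unit_of \<phi>" A] s Funit[OF s(4)] by (simp add: Hom_def)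
    then obtain j where "component (on_mor F (unit_inclusion \<phi>)) 1 = {j}"
      using FInert[OF s(1)] unfolding Inert_Gamma_iff[OF h] by auto
    then show "component (on_mor F (unit_inclusion \<phi>)) 1 = {e \<phi>}"
      by (simp add: e_def)
    then show "e \<phi> \<in> {1..on_obj F A}"
      using component_range[OF h] by blast
  qed
  \<comment> \<open>The retraction undoes the inclusion, so its entry at \<open>e \<psi>\<close> is
    \<open>{1}\<close>. As the target is 1, disjointness leaves nothing for the other
    entries.\<close>
  have ret: "component (on_mor F (unit_retraction \<psi>)) q \<noteq> {} \<longleftrightarrow> q = e \<psi>"
    if \<psi>: "\<psi> \<in> elementary_moments C B" for \<psi> B q
  proof -
    note t = elementary_splitting[OF \<psi>]
    have h: "on_mor F (unit_retraction \<psi>) \<in> Hom Gamma (on_obj F B) 1"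
      using FHom[of "unit_retraction \<psi>" B "unit_of \<psi>"] t Funit[OF t(4)] by (simp add: Hom_def)
    have "Comp Gamma (on_mor F (unit_retraction \<psi>)) (on_mor F (unit_inclusion \<psi>)) = Id Gamma 1"
      using FComp[of "unit_inclusion \<psi>" "unit_retraction \<psi>"] t FId[OF unit_Obj[OF t(4)]] Funit[OF t(4)]
      by simp
    then have "component (Comp Gamma (on_mor F (unit_retraction \<psi>)) (on_mor F (unit_inclusion \<psi>))) 1 = {1}"
      by simp
    then have "component (on_mor F (unit_retraction \<psi>)) (e \<psi>) = {1}"
      using e(1)[OF \<psi>] by simp
    moreover have "component (on_mor F (unit_retraction \<psi>)) q \<subseteq> {1..1}"
      using component_range[OF h] by blast
    ultimately show ?thesis
      using component_disjoint[OF h, of 1 q "e \<psi>"] by (auto simp: subset_singleton_iff)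
  qed
  \<comment> \<open>Apply the functor to the map that defines incidence: the inclusion selects the
    entry at \<open>e \<phi>\<close>, and the retraction sees only the element
    \<open>e \<psi>\<close> of it.\<close>
  have inc_iff: "incident f \<phi> \<psi> \<longleftrightarrow> e \<psi> \<in> component (on_mor F f) (e \<phi>)"
    if f: "f \<in> Hom C A B" and \<phi>: "\<phi> \<in> elementary_moments C A" and \<psi>: "\<psi> \<in> elementary_moments C B"
    for f A B \<phi> \<psi>
  proof -
    note s = elementary_splitting[OF \<phi>] and t = elementary_splitting[OF \<psi>]
    have [simp]: "f \<in> Mor C" "Dom C f = A" "Cod C f = B"
      using f by (auto simp: Hom_def)
    note [simp] = s(2,3) t(7,8,9)
    have "incident f \<phi> \<psi> \<longleftrightarrow> component (on_mor F (unit_retraction \<psi> \<cdot> (f \<cdot> unit_inclusion \<phi>))) 1 \<noteq> {}"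
      unfolding incident_def by (rule Iso_iff[OF s(4) t(4)]) (simp add: Hom_def)
    also have "\<dots> \<longleftrightarrow> e \<psi> \<in> component (on_mor F f) (e \<phi>)"
      using e(1)[OF \<phi>] ret[OF \<psi>] by (auto simp: FComp)
    finally show ?thesis .
  qed
  \<comment> \<open>Moments with equal numbers are incident along the identity, hence equal.\<close>
  have inj: "inj_on e (elementary_moments C A)" for A
  proof (rule inj_onI)
    fix \<phi> \<psi> assume \<phi>: "\<phi> \<in> elementary_moments C A" and \<psi>: "\<psi> \<in> elementary_moments C A"
      and eq: "e \<phi> = e \<psi>"
    have A: "A \<in> Obj C"
      using elementary_Obj[OF \<phi>] .
    have "incident (Id C A) \<phi> \<psi>"
      using inc_iff[OF Id_in_Hom[OF A] \<phi> \<psi>] FId[OF A] e(2)[OF \<psi>] eq by simp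
    then show "\<phi> = \<psi>"
      using incident_Id_iff[OF \<phi> \<psi>] by simp
  qed
  have bij: "bij_betw e (elementary_moments C A) {1..on_obj F A}" if A: "A \<in> Obj C" for A
  proof -
    \<comment> \<open>The numbering is injective into an interval of the same finite cardinality, so
      it is onto.\<close>
    have "card (e ` elementary_moments C A) = card {1..on_obj F A}"
      using card_image[OF inj] Fcard[OF A] bij_betw_same_card unfolding eqpoll_def by metis
    then have "e ` elementary_moments C A = {1..on_obj F A}"
      using e(2) by (intro card_subset_eq) auto
    then show ?thesis
      using inj by (simp add: bij_betw_def)
  qed
  have image: "component (on_mor F f) (e \<phi>) = e ` {\<psi> \<in> elementary_moments C B. incident f \<phi> \<psi>}"
    if f: "f \<in> Hom C A B" and \<phi>: "\<phi> \<in> elementary_moments C A" for f A B \<phi>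
  proof -
    have B: "B \<in> Obj C"
      using f Cod_in_Obj by (auto simp: Hom_def)
    have "component (on_mor F f) (e \<phi>) \<subseteq> e ` elementary_moments C B"
      unfolding bij_betw_imp_surj_on[OF bij[OF B]] using component_range[OF FHom[OF f]] by blast
    then show ?thesis
      using inc_iff[OF f \<phi>] by blast
  qed
  show ?thesis
    by (rule that[OF bij image])
qed

text \<open>Both functors describe the same incidence relation in their own numberings, so the
  change of numbering is natural.\<close>

lemma functors_to_Gamma_isomorphic:
  assumes F: "moment_functor C Gamma F" "cardinality_preserving C Gamma F" "unit_preserving C Gamma F"
    and G: "moment_functor C Gamma G" "cardinality_preserving C Gamma G" "unit_preserving C Gamma G"
  shows "naturally_isomorphic C Gamma F G"
proof -
  obtain e where e: "\<And>A. A \<in> Obj C \<Longrightarrow> bij_betw e (elementary_moments C A) {1..on_obj F A}"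
    "\<And>A B f \<phi>. f \<in> Hom C A B \<Longrightarrow> \<phi> \<in> elementary_moments C A \<Longrightarrow>
      component (on_mor F f) (e \<phi>) = e ` {\<psi> \<in> elementary_moments C B. incident f \<phi> \<psi>}"
    using functor_to_Gamma_incidence[OF F] by blast
  obtain d where d: "\<And>A. A \<in> Obj C \<Longrightarrow> bij_betw d (elementary_moments C A) {1..on_obj G A}"
    "\<And>A B f \<phi>. f \<in> Hom C A B \<Longrightarrow> \<phi> \<in> elementary_moments C A \<Longrightarrow>
      component (on_mor G f) (d \<phi>) = d ` {\<psi> \<in> elementary_moments C B. incident f \<phi> \<psi>}"
    using functor_to_Gamma_incidence[OF G] by blast
  define b where "b A = d \<circ> the_inv_into (elementary_moments C A) e" for A
  have b: "bij_betw (b A) {1..on_obj F A} {1..on_obj G A}" if "A \<in> Obj C" for A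
    unfolding b_def using bij_betw_the_inv_into[OF e(1)[OF that]] d(1)[OF that] by (rule bij_betw_trans)
  have b_e: "b A (e \<phi>) = d \<phi>" if "A \<in> Obj C" "\<phi> \<in> elementary_moments C A" for A \<phi>
    using that e(1)[OF that(1)] by (simp add: b_def bij_betw_def the_inv_into_f_f)
  define \<eta> where "\<eta> A = (on_obj F A, \<lambda>p. if p \<in> {1..on_obj F A} then {b A p} else {}, on_obj G A)" for A
  have \<eta>: "\<eta> A \<in> Iso Gamma (on_obj F A) (on_obj G A)" if "A \<in> Obj C" for A
    unfolding \<eta>_def using Iso_GammaI[OF b[OF that]] .
  have "Comp Gamma (on_mor G f) (\<eta> (Dom C f)) = Comp Gamma (\<eta> (Cod C f)) (on_mor F f)"
    if f: "f \<in> Mor C" for f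
  proof -
    define A B where "A = Dom C f" and "B = Cod C f"
    have f': "f \<in> Hom C A B" and A: "A \<in> Obj C" and B: "B \<in> Obj C"
      using f Dom_in_Obj Cod_in_Obj by (auto simp: A_def B_def Hom_def)
    have Ff: "on_mor F f \<in> Hom Gamma (on_obj F A) (on_obj F B)"
      and Gf: "on_mor G f \<in> Hom Gamma (on_obj G A) (on_obj G B)"
      using F(1) G(1) f by (auto simp: moment_functor_def is_functor_def A_def B_def)
    have \<eta>A: "\<eta> A \<in> Hom Gamma (on_obj F A) (on_obj G A)" and \<eta>B: "\<eta> B \<in> Hom Gamma (on_obj F B) (on_obj G B)"
      using \<eta>[OF A] \<eta>[OF B] by (auto simp: Iso_def)
    have "Comp Gamma (on_mor G f) (\<eta> A) = Comp Gamma (\<eta> B) (on_mor F f)"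
      using Comp_Gamma_Hom[OF \<eta>A Gf] Comp_Gamma_Hom[OF Ff \<eta>B]
    proof (rule Gamma_eqI)
      fix p assume p: "p \<in> {1..on_obj F A}"
      then obtain \<phi> where \<phi>: "\<phi> \<in> elementary_moments C A" "p = e \<phi>"
        using bij_betw_imp_surj_on[OF e(1)[OF A]] by blast
      have \<eta>e: "component (\<eta> D) (e \<psi>) = {d \<psi>}" if "D \<in> Obj C" "\<psi> \<in> elementary_moments C D" for D \<psi>
        using b_e[OF that] bij_betwE[OF e(1)[OF that(1)]] that(2) by (simp add: \<eta>_def)
      show "component (Comp Gamma (on_mor G f) (\<eta> A)) p = component (Comp Gamma (\<eta> B) (on_mor F f)) p"
        using \<eta>e[OF B] by (auto simp: \<phi>(2) \<eta>e[OF A \<phi>(1)] e(2)[OF f' \<phi>(1)] d(2)[OF f' \<phi>(1)])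
    qed
    then show ?thesis
      by (simp add: A_def B_def)
  qed
  then show ?thesis
    unfolding naturally_isomorphic_def using \<eta> by blast
qed

text \<open>The argument \<open>e\<close> depends on the object because the numberings are chosen
  one object at a time. If no moment has number \<open>p\<close>, the \<open>p\<close>-th entry is
  empty, as the encoding of tuples requires.\<close>

definition incidence_functor :: "('o \<Rightarrow> 'a \<Rightarrow> nat) \<Rightarrow> ('o, 'a, nat, gamma_mor) cat_functor" where
  "incidence_functor e = \<lparr>
     on_obj = (\<lambda>A. card (elementary_moments C A)),
     on_mor = (\<lambda>f. (card (elementary_moments C (Dom C f)),
       \<lambda>p. {e (Cod C f) \<psi> | \<phi> \<psi>. \<phi> \<in> elementary_moments C (Dom C f) \<and>
         \<psi> \<in> elementary_moments C (Cod C f) \<and> e (Dom C f) \<phi> = p \<and> incident f \<phi> \<psi>},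
       card (elementary_moments C (Cod C f))))\<rparr>"

text \<open>Each clause translates one fact on incidence: unique sources give disjoint entries,
  incidence along identities and composites gives functoriality, and existence of sources or unique
  targets handles active or inert maps.\<close>

lemma incidence_functor_properties:
  assumes e: "\<And>A. A \<in> Obj C \<Longrightarrow> bij_betw (e A) (elementary_moments C A) {1..card (elementary_moments C A)}"
  shows "moment_functor C Gamma (incidence_functor e)"
    "cardinality_preserving C Gamma (incidence_functor e)"
    "unit_preserving C Gamma (incidence_functor e)"
proof -
  let ?F = "incidence_functor e"
  have F_obj: "on_obj ?F A = card (elementary_moments C A)" for A
    by (simp add: incidence_functor_def)
  have inj: "e A \<phi> = e A \<psi> \<longleftrightarrow> \<phi> = \<psi>"
    if "\<phi> \<in> elementary_moments C A" "\<psi> \<in> elementary_moments C A" for A \<phi> \<psi>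
    using that bij_betw_imp_inj_on[OF e[OF elementary_Obj]] by (auto dest: inj_onD)
  have range: "e A \<phi> \<in> {1..card (elementary_moments C A)}" if "\<phi> \<in> elementary_moments C A" for A \<phi>
    using that bij_betwE[OF e[OF elementary_Obj]] by blast
  have surj: "\<exists>\<phi> \<in> elementary_moments C A. p = e A \<phi>"
    if "A \<in> Obj C" "p \<in> {1..card (elementary_moments C A)}" for A p
    using bij_betw_imp_surj_on[OF e[OF that(1)]] that(2) by blast
  \<comment> \<open>By injectivity of the numbering, \<open>\<phi>\<close> is the only moment that
    contributes to the entry at its number.\<close>
  have comp: "component (on_mor ?F f) (e A \<phi>) = e B ` {\<psi> \<in> elementary_moments C B. incident f \<phi> \<psi>}"
    if f: "f \<in> Hom C A B" and \<phi>: "\<phi> \<in> elementary_moments C A" for f A B \<phi>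
  proof -
    have "Dom C f = A" "Cod C f = B"
      using f by (auto simp: Hom_def)
    then show ?thesis
      using inj[OF _ \<phi>] \<phi> by (auto simp: incidence_functor_def)
  qed
  have F_Hom: "on_mor ?F f \<in> Hom Gamma (on_obj ?F A) (on_obj ?F B)" if f: "f \<in> Hom C A B" for f A B
  proof -
    have AB: "Dom C f = A" "Cod C f = B"
      using f by (auto simp: Hom_def)
    show ?thesis
      unfolding incidence_functor_def cat_functor.simps AB
    proof (rule Gamma_HomI)
      fix p j
      assume "j \<in> {e B \<psi> | \<phi> \<psi>. \<phi> \<in> elementary_moments C A \<and> \<psi> \<in> elementary_moments C B \<and>
        e A \<phi> = p \<and> incident f \<phi> \<psi>}"
      then show "p \<in> {1..card (elementary_moments C A)} \<and> j \<in> {1..card (elementary_moments C B)}"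
        using range by blast
    next
      fix p q j
      assume "j \<in> {e B \<psi> | \<phi> \<psi>. \<phi> \<in> elementary_moments C A \<and> \<psi> \<in> elementary_moments C B \<and>
          e A \<phi> = p \<and> incident f \<phi> \<psi>}"
        "j \<in> {e B \<psi> | \<phi> \<psi>. \<phi> \<in> elementary_moments C A \<and> \<psi> \<in> elementary_moments C B \<and>
          e A \<phi> = q \<and> incident f \<phi> \<psi>}"
      then show "p = q"
        using inj incident_unique_source[OF f] by blast
    qed
  qed
  have "on_mor ?F (Id C A) = Id Gamma (on_obj ?F A)" if A: "A \<in> Obj C" for A
    using F_Hom[OF Id_in_Hom[OF A]] Id_Gamma_Hom
  proof (rule Gamma_eqI)
    fix p assume p: "p \<in> {1..on_obj ?F A}"
    then obtain \<phi> where \<phi>: "\<phi> \<in> elementary_moments C A" "p = e A \<phi>"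
      using surj[OF A] F_obj by auto
    have "{\<psi> \<in> elementary_moments C A. incident (Id C A) \<phi> \<psi>} = {\<phi>}"
      using incident_Id_iff \<phi>(1) by blast
    then show "component (on_mor ?F (Id C A)) p = component (Id Gamma (on_obj ?F A)) p"
      using p unfolding \<phi>(2) comp[OF Id_in_Hom[OF A] \<phi>(1)] by simp
  qed
  moreover have "on_mor ?F (g \<cdot> f) = Comp Gamma (on_mor ?F g) (on_mor ?F f)"
    if fg: "f \<in> Mor C" "g \<in> Mor C" "Cod C f = Dom C g" for f g
  proof -
    have f: "f \<in> Hom C (Dom C f) (Dom C g)" and g: "g \<in> Hom C (Dom C g) (Cod C g)"
      using fg by (simp_all add: Hom_def)
    note gf = Comp_in_Hom[OF f g]
    show ?thesis
      using F_Hom[OF gf] Comp_Gamma_Hom[OF F_Hom[OF f] F_Hom[OF g]]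
    proof (rule Gamma_eqI)
      fix p assume "p \<in> {1..on_obj ?F (Dom C f)}"
      then obtain \<phi> where \<phi>: "\<phi> \<in> elementary_moments C (Dom C f)" "p = e (Dom C f) \<phi>"
        using surj[OF Dom_in_Obj[OF fg(1)]] F_obj by auto
      have "component (Comp Gamma (on_mor ?F g) (on_mor ?F f)) p =
          (\<Union>\<psi> \<in> {\<psi> \<in> elementary_moments C (Dom C g). incident f \<phi> \<psi>}.
            e (Cod C g) ` {\<omega> \<in> elementary_moments C (Cod C g). incident g \<psi> \<omega>})"
        using comp[OF g] by (simp add: \<phi>(2) comp[OF f \<phi>(1)])
      also have "\<dots> = e (Cod C g) ` {\<omega> \<in> elementary_moments C (Cod C g). incident (g \<cdot> f) \<phi> \<omega>}"
        using incident_Comp[OF f g \<phi>(1)] by blast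
      also have "\<dots> = component (on_mor ?F (g \<cdot> f)) p"
        by (simp add: \<phi>(2) comp[OF gf \<phi>(1)])
      finally show "component (on_mor ?F (g \<cdot> f)) p =
          component (Comp Gamma (on_mor ?F g) (on_mor ?F f)) p"
        by simp
    qed
  qed
  moreover have "on_mor ?F f \<in> Act Gamma" if f: "f \<in> Act C" for f
  proof -
    have f': "f \<in> Hom C (Dom C f) (Cod C f)"
      using Act_Mor[OF f] by (simp add: Hom_def)
    have "\<exists>p. j \<in> component (on_mor ?F f) p" if j: "j \<in> {1..on_obj ?F (Cod C f)}" for j
    proof -
      obtain \<psi> where \<psi>: "\<psi> \<in> elementary_moments C (Cod C f)" "j = e (Cod C f) \<psi>"
        using surj[OF Cod_in_Obj[OF Act_Mor[OF f]]] j F_obj by auto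
      obtain \<phi> where \<phi>: "\<phi> \<in> elementary_moments C (Dom C f)" "incident f \<phi> \<psi>"
        using incident_active_source[OF f f' \<psi>(1)] .
      have "j \<in> component (on_mor ?F f) (e (Dom C f) \<phi>)"
        using comp[OF f' \<phi>(1)] \<phi>(2) \<psi> by blast
      then show ?thesis ..
    qed
    then show ?thesis
      using Act_Gamma_iff[OF F_Hom[OF f']] by blast
  qed
  moreover have "on_mor ?F f \<in> Inert Gamma" if f: "f \<in> Inert C" for f
  proof -
    have f': "f \<in> Hom C (Dom C f) (Cod C f)"
      using Inert_Mor[OF f] by (simp add: Hom_def)
    have "\<exists>j. component (on_mor ?F f) p = {j}" if p: "p \<in> {1..on_obj ?F (Dom C f)}" for p
    proof -
      obtain \<phi> where \<phi>: "\<phi> \<in> elementary_moments C (Dom C f)" "p = e (Dom C f) \<phi>"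
        using surj[OF Dom_in_Obj[OF Inert_Mor[OF f]]] p F_obj by auto
      obtain \<psi> where "{\<psi> \<in> elementary_moments C (Cod C f). incident f \<phi> \<psi>} = {\<psi>}"
        using incident_inert_target[OF f f' \<phi>(1)] by blast
      then show ?thesis
        using comp[OF f' \<phi>(1)] \<phi>(2) by simp
    qed
    then show ?thesis
      using Inert_Gamma_iff[OF F_Hom[OF f']] by blast
  qed
  ultimately show "moment_functor C Gamma ?F"
    using F_Hom unfolding moment_functor_def is_functor_def by (simp add: Hom_def) (simp add: Gamma_def)
  have "elementary_moments C A \<approx> elementary_moments Gamma (on_obj ?F A)" if A: "A \<in> Obj C" for A
  proof -
    have "elementary_moments C A \<approx> {1..on_obj ?F A}"
      using e[OF A] unfolding F_obj eqpoll_def by blast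
    then show ?thesis
      using elementary_moments_Gamma_eqpoll by (rule eqpoll_trans)
  qed
  then show "cardinality_preserving C Gamma ?F"
    by (simp add: cardinality_preserving_def)
  have "on_obj ?F U = 1" if "unit_object C U" for U
    using unit_elementary_moments[OF that] F_obj by fastforce
  then show "unit_preserving C Gamma ?F"
    by (simp add: unit_preserving_def unit_object_Gamma_1)
qed

end

theorem proposition2p6:
  fixes C :: "('o, 'a) factorised_precategory"
  assumes "finite_type_unital_moment_category C"
  shows "(\<exists>\<gamma>. moment_functor C Gamma \<gamma> \<and> cardinality_preserving C Gamma \<gamma> \<and>
              unit_preserving C Gamma \<gamma>) \<and>
         (\<forall>\<gamma> \<gamma>'. moment_functor C Gamma \<gamma> \<and> cardinality_preserving C Gamma \<gamma> \<and>
              unit_preserving C Gamma \<gamma> \<and>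
              moment_functor C Gamma \<gamma>' \<and> cardinality_preserving C Gamma \<gamma>' \<and>
              unit_preserving C Gamma \<gamma>' \<longrightarrow>
              naturally_isomorphic C Gamma \<gamma> \<gamma>')"
proof -
  interpret finite_type_unital_moment_category C
    by fact
  \<comment> \<open>Finite type provides the numberings from which the functor is built.\<close>
  have "\<exists>b. bij_betw b (elementary_moments C A) {1..card (elementary_moments C A)}"
    if "A \<in> Obj C" for A
    using finite_cardinality[OF that] by (intro finite_same_card_bij) simp_all
  then obtain e where "\<And>A. A \<in> Obj C \<Longrightarrow>
      bij_betw (e A) (elementary_moments C A) {1..card (elementary_moments C A)}"
    by metis
  from incidence_functor_properties[OF this] functors_to_Gamma_isomorphic show ?thesis
    by blast
qed

end
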